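(* The following hold. (1) $M^{m*} (3,2) = 2$, and $\mu_3^{m*}(B)= M^{m*} (3,2)$ for $B \in \mathcal{K}^2_o$ whenever $B$ is a parallelogram. (2) For any $n \geq 4$, $M^{m*}(n,2) = 4$, and $\mu_n^{m*}(B)= M^{m*} (n,2)$ for $B \in \mathcal{K}^2_o$ whenever $B$ is a parallelogram. (3) $m^{m*}(4,2)=2$, and $\mu_4^{m*}(B)= m^{m*} (4,2)$ for $B \in \mathcal{K}^2_o$ whenever $\operatorname{bd} (B)$ is a Radon curve. (4) If $n \geq 3$, then there is some $B \in \mathcal{K}^2_o$ such that $\mu_n^{m*}(B)= m^{m*} (n,2)$ and $\operatorname{bd} (B)$ is a Radon curve.
   Context: $\lambda_2$ denotes area (Lebesgue measure) in $\mathbb{R}^2$; $o$ is the origin; $\operatorname{bd}$ denotes boundary. $\mathcal{K}^2_o$ is the family of $o$-symmetric convex bodies (compact convex sets with nonempty interior) in $\mathbb{R}^2$. For $B\in\mathcal{K}^2_o$, let $C(B)$ be a minimum area parallelogram circumscribed about $B$ (i.e. containing $B$). Gromov's mass$^*$ of a set $S\subset\mathbb{R}^2$ in the normed plane with unit disk $B$ is the multiple of Lebesgue measure normalized so that $C(B)$ has measure $2^2=4$, i.e. $\operatorname{vol}^{m*}_B(S)=\frac{4\lambda_2(S)}{\lambda_2(C(B))}$. For $n\ge 3$, $$\mu_n^{m*}(B)=\sup\{\operatorname{vol}_B^{m*}(Q): Q \text{ is a convex polygon contained in } B \text{ with at most } n \text{ vertices}\},$$ $m^{m*}(n,2)=\inf\{\mu_n^{m*}(B):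 B\in\mathcal{K}^2_o\}$ and $M^{m*}(n,2)=\sup\{\mu_n^{m*}(B): B\in\mathcal{K}^2_o\}$. An $o$-symmetric closed, convex, continuous curve $\Gamma$ in the plane is called a Radon curve if every point of $\Gamma$ is a vertex of some maximum area parallelogram inscribed in $\Gamma$. *)

theory Defs
  imports "HOL-Analysis.Analysis"
begin

type_synonym plane = "real ^ 2"

abbreviation area :: "plane set \<Rightarrow> real" where
  "area S \<equiv> measure lebesgue S"

definition o_symmetric :: "plane set \<Rightarrow> bool" where
  "o_symmetric S \<longleftrightarrow> uminus ` S = S"

definition K2o :: "plane set set" where
  "K2o = {B. compact B \<and> convex B \<and> interior B \<noteq> {} \<and> o_symmetric B}"

definition vertices :: "plane set \<Rightarrow> plane set" where
  "vertices P = {x. x extreme_point_of P}"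

text \<open>Polygons and parallelograms are solid (the region, not its boundary) and nondegenerate.\<close>

definition convex_polygon :: "plane set \<Rightarrow> bool" where
  "convex_polygon Q \<longleftrightarrow> polytope Q \<and> interior Q \<noteq> {}"

definition parallelogram :: "plane set \<Rightarrow> bool" where
  "parallelogram P \<longleftrightarrow>
     (\<exists>a u v. \<not> collinear {0, u, v} \<and> P = convex hull {a, a + u, a + u + v, a + v})"

definition min_circumscribed_parallelogram :: "plane set \<Rightarrow> plane set \<Rightarrow> bool" where
  "min_circumscribed_parallelogram B P \<longleftrightarrow>
     parallelogram P \<and> B \<subseteq> P \<and>
     (\<forall>P'. parallelogram P' \<and> B \<subseteq> P' \<longrightarrow> area P \<le> area P')"

text \<open>A minimizer exists for every \<open>B \<in> K2o\<close>; it need not be unique, but only its area is used.\<close>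

definition min_circ :: "plane set \<Rightarrow> plane set" where
  "min_circ B = (SOME P. min_circumscribed_parallelogram B P)"

definition vol_mstar :: "plane set \<Rightarrow> plane set \<Rightarrow> real" where
  "vol_mstar B S = 4 * area S / area (min_circ B)"

definition mu_mstar :: "nat \<Rightarrow> plane set \<Rightarrow> real" where
  "mu_mstar n B =
     Sup {vol_mstar B Q | Q. convex_polygon Q \<and> Q \<subseteq> B \<and> card (vertices Q) \<le> n}"

definition m_mstar :: "nat \<Rightarrow> real" where
  "m_mstar n = (INF B\<in>K2o. mu_mstar n B)"

definition M_mstar :: "nat \<Rightarrow> real" where
  "M_mstar n = (SUP B\<in>K2o. mu_mstar n B)"

definition closed_convex_curve :: "plane set \<Rightarrow> bool" where
  "closed_convex_curve \<Gamma> \<longleftrightarrow>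
     (\<exists>g. simple_path g \<and> pathfinish g = pathstart g \<and> path_image g = \<Gamma>) \<and>
     convex (inside \<Gamma>)"

definition inscribed_parallelogram :: "plane set \<Rightarrow> plane set \<Rightarrow> bool" where
  "inscribed_parallelogram \<Gamma> P \<longleftrightarrow> parallelogram P \<and> vertices P \<subseteq> \<Gamma>"

definition max_inscribed_parallelogram :: "plane set \<Rightarrow> plane set \<Rightarrow> bool" where
  "max_inscribed_parallelogram \<Gamma> P \<longleftrightarrow>
     inscribed_parallelogram \<Gamma> P \<and>
     (\<forall>P'. inscribed_parallelogram \<Gamma> P' \<longrightarrow> area P' \<le> area P)"

definition radon_curve :: "plane set \<Rightarrow> bool" where
  "radon_curve \<Gamma> \<longleftrightarrow>
     o_symmetric \<Gamma> \<and> closed_convex_curve \<Gamma> \<and>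
     (\<forall>x\<in>\<Gamma>. \<exists>P. max_inscribed_parallelogram \<Gamma> P \<and> x \<in> vertices P)"

end

theory Submission
  imports Defs "HOL-Complex_Analysis.Great_Picard"
begin

text \<open>
  Write \<open>det2 x y\<close> for the determinant form and let the polar of \<open>B\<close> consist of all \<open>p\<close> with
  \<open>\<bar>det2 p z\<bar> \<le> 1\<close> for \<open>z \<in> B\<close>. An \<open>o\<close>-symmetric parallelogram circumscribed about \<open>B\<close> is given by
  two points \<open>p, q\<close> of the polar and has area \<open>4 / \<bar>det2 p q\<bar>\<close>, so the minimum area circumscribed
  parallelogram has area \<open>4 / D\<close>, where \<open>D\<close> is the maximum of \<open>det2\<close> on the polar.

  The key notion is a bounded self-polar set. It is the same as a maximal set on which
  \<open>\<bar>det2\<bar> \<le> 1\<close> holds pairwise, its boundary is a Radon curve, and its minimum area circumscribed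
  parallelogram has area 4. Extending the polar of \<open>B\<close>, rescaled so that \<open>D = 1\<close>, to a maximal such
  set and using the bipolar theorem, one finds in every \<open>B\<close> a homothetic copy of a self-polar set
  with the same area of the minimum circumscribed parallelogram. Hence the infimum of
  \<open>mu_mstar n\<close> may be taken over self-polar sets, and by a unimodular linear map over those that contain
  the two unit vectors. These are contained in a fixed square and the corresponding norms are
  equicontinuous, so the theorem of Arzela and Ascoli yields a self-polar minimizer.

  For \<open>n = 4\<close>, a quadrilateral has half the area of the parallelogram spanned by its diagonals, and
  half a diagonal again lies in \<open>B\<close>; so the largest quadrilateral has area twice the maximum of \<open>det2\<close>
  on \<open>B\<close>. The Radon property says that \<open>B\<close> is self-polar up to scaling.
\<close>

section \<open>The determinant form and parallelograms\<close>

definition det2 :: "plane \<Rightarrow> plane \<Rightarrow> real" where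
  "det2 x y = x $ 1 * y $ 2 - x $ 2 * y $ 1"

lemma det2_linear_simps [simp]:
  "det2 (x + y) z = det2 x z + det2 y z" "det2 z (x + y) = det2 z x + det2 z y"
  "det2 (x - y) z = det2 x z - det2 y z" "det2 z (x - y) = det2 z x - det2 z y"
  "det2 (- x) z = - det2 x z" "det2 z (- x) = - det2 z x"
  "det2 (c *\<^sub>R x) z = c * det2 x z" "det2 z (c *\<^sub>R x) = c * det2 z x"
  "det2 0 z = 0" "det2 z 0 = 0" "det2 x x = 0"
  by (simp_all add: det2_def algebra_simps)

lemma det2_swap: "det2 y x = - det2 x y"
  by (simp add: det2_def)

lemma abs_det2_commute: "\<bar>det2 x y\<bar> = \<bar>det2 y x\<bar>"
  by (simp add: det2_swap[of y x])

lemma plane_eq_iff: "x = y \<longleftrightarrow> x $ 1 = y $ 1 \<and> x $ 2 = y $ 2" for x y :: plane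
  by (simp add: vec_eq_iff forall_2)

text \<open>Cramer's rule, kept free of division so that it also covers dependent \<open>u\<close>,
  \<open>v\<close>.\<close>

lemma det2_scaled_identity: "det2 u v *\<^sub>R z = det2 z v *\<^sub>R u + det2 u z *\<^sub>R v"
  by (simp add: plane_eq_iff det2_def algebra_simps)

lemma abs_det2_le_norm: "\<bar>det2 x y\<bar> \<le> norm x * norm y"
proof -
  have "(det2 x y)\<^sup>2 \<le> (norm x)\<^sup>2 * (norm y)\<^sup>2"
  proof -
    \<comment> \<open>Lagrange's identity: the last square is that of the inner product.\<close>
    have "(norm x)\<^sup>2 * (norm y)\<^sup>2 = (det2 x y)\<^sup>2 + (x $ 1 * y $ 1 + x $ 2 * y $ 2)\<^sup>2"
      by (simp add: power2_norm_eq_inner inner_vec_def sum_2 det2_def)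
         (simp add: power2_eq_square algebra_simps)
    then show ?thesis by simp
  qed
  then show ?thesis
    by (metis abs_le_square_iff abs_mult abs_norm_cancel power_mult_distrib)
qed

lemma continuous_on_det2 [continuous_intros]:
  "continuous_on S f \<Longrightarrow> continuous_on S g \<Longrightarrow> continuous_on S (\<lambda>x. det2 (f x) (g x))"
  unfolding det2_def by (intro continuous_intros)

lemma collinear_0_iff_det2: "collinear {0, u, v} \<longleftrightarrow> det2 u v = 0"
proof
  assume "collinear {0, u, v}"
  then show "det2 u v = 0" by (auto simp: collinear_lemma)
next
  assume eq: "det2 u v = 0"
  show "collinear {0, u, v}"
  proof (cases "u = 0")
    case False
    then consider "u $ 1 \<noteq> 0" | "u $ 2 \<noteq> 0" by (auto simp: plane_eq_iff)
    then have "\<exists>c. v = c *\<^sub>R u"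
    proof cases
      case 1
      then have "v = (v $ 1 / u $ 1) *\<^sub>R u" using eq by (simp add: plane_eq_iff det2_def field_simps)
      then show ?thesis by blast
    next
      case 2
      then have "v = (v $ 2 / u $ 2) *\<^sub>R u" using eq by (simp add: plane_eq_iff det2_def field_simps)
      then show ?thesis by blast
    qed
    then show ?thesis by (auto simp: collinear_lemma)
  qed (simp add: collinear_lemma)
qed

lemma parallelogram_hull_eq:
  fixes a u v :: plane
  shows "convex hull {a, a + u, a + u + v, a + v} = (\<lambda>z::plane. a + (z $ 1 *\<^sub>R u + z $ 2 *\<^sub>R v)) ` cbox 0 1"
    (is "?H = ?I")
proof
  have lin: "linear (\<lambda>z::plane. z $ 1 *\<^sub>R u + z $ 2 *\<^sub>R v)"
    by (auto intro!: linearI simp: algebra_simps)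
  have "?I = (+) a ` (\<lambda>z::plane. z $ 1 *\<^sub>R u + z $ 2 *\<^sub>R v) ` cbox 0 1" by (simp add: image_image)
  then have "convex ?I"
    by (simp only:) (intro convex_translation convex_linear_image lin convex_box)
  moreover have "\<exists>z\<in>cbox 0 (1::plane). x = a + (z $ 1 *\<^sub>R u + z $ 2 *\<^sub>R v)"
    if "x \<in> {a, a + u, a + u + v, a + v}" for x
    using that
  proof (elim insertE emptyE)
    assume "x = a" then show ?thesis by (intro bexI[of _ 0]) (auto simp: mem_box_cart)
  next
    assume "x = a + u" then show ?thesis
      by (intro bexI[of _ "vector [1,0]"]) (auto simp: mem_box_cart forall_2)
  next
    assume "x = a + u + v" then show ?thesis
      by (intro bexI[of _ "vector [1,1]"]) (auto simp: mem_box_cart forall_2)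
  next
    assume "x = a + v" then show ?thesis
      by (intro bexI[of _ "vector [0,1]"]) (auto simp: mem_box_cart forall_2)
  qed
  ultimately show "?H \<subseteq> ?I" by (intro hull_minimal subsetI) (simp_all only: image_iff)
next
  show "?I \<subseteq> ?H"
  proof clarify
    fix z :: plane assume "z \<in> cbox 0 1"
    then have z: "0 \<le> z $ 1" "z $ 1 \<le> 1" "0 \<le> z $ 2" "z $ 2 \<le> 1" by (auto simp: mem_box_cart)
    have H: "x \<in> {a, a + u, a + u + v, a + v} \<Longrightarrow> x \<in> ?H" for x by (rule hull_inc)
    \<comment> \<open>Interpolate in the direction \<open>u\<close> on two opposite edges, then
      between the two resulting points in the direction \<open>v\<close>.\<close>
    have "(1 - z $ 1) *\<^sub>R a + z $ 1 *\<^sub>R (a + u) \<in> ?H"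
      by (intro convexD_alt convex_convex_hull H) (use z in auto)
    moreover have "(1 - z $ 1) *\<^sub>R (a + v) + z $ 1 *\<^sub>R (a + u + v) \<in> ?H"
      by (intro convexD_alt convex_convex_hull H) (use z in auto)
    ultimately have "(1 - z $ 2) *\<^sub>R ((1 - z $ 1) *\<^sub>R a + z $ 1 *\<^sub>R (a + u)) +
        z $ 2 *\<^sub>R ((1 - z $ 1) *\<^sub>R (a + v) + z $ 1 *\<^sub>R (a + u + v)) \<in> ?H"
      by (rule convexD_alt[OF convex_convex_hull]) (use z in auto)
    also have "(1 - z $ 2) *\<^sub>R ((1 - z $ 1) *\<^sub>R a + z $ 1 *\<^sub>R (a + u)) +
        z $ 2 *\<^sub>R ((1 - z $ 1) *\<^sub>R (a + v) + z $ 1 *\<^sub>R (a + u + v)) =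
        a + (z $ 1 *\<^sub>R u + z $ 2 *\<^sub>R v)"
      by (simp add: plane_eq_iff algebra_simps)
    finally show "a + (z $ 1 *\<^sub>R u + z $ 2 *\<^sub>R v) \<in> ?H" .
  qed
qed

lemma parallelogram_hull_iff:
  fixes a u v :: plane
  shows "x \<in> convex hull {a, a + u, a + u + v, a + v} \<longleftrightarrow>
    (\<exists>s t. 0 \<le> s \<and> s \<le> 1 \<and> 0 \<le> t \<and> t \<le> 1 \<and> x = a + (s *\<^sub>R u + t *\<^sub>R v))"
proof
  assume "x \<in> convex hull {a, a + u, a + u + v, a + v}"
  then show "\<exists>s t. 0 \<le> s \<and> s \<le> 1 \<and> 0 \<le> t \<and> t \<le> 1 \<and> x = a + (s *\<^sub>R u + t *\<^sub>R v)"
    unfolding parallelogram_hull_eq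
    by (elim imageE) (simp add: mem_box_cart, metis)
next
  assume "\<exists>s t. 0 \<le> s \<and> s \<le> 1 \<and> 0 \<le> t \<and> t \<le> 1 \<and> x = a + (s *\<^sub>R u + t *\<^sub>R v)"
  then obtain s t where "0 \<le> s" "s \<le> 1" "0 \<le> t" "t \<le> 1" "x = a + (s *\<^sub>R u + t *\<^sub>R v)" by blast
  then show "x \<in> convex hull {a, a + u, a + u + v, a + v}"
    unfolding parallelogram_hull_eq
    by (intro image_eqI[of _ _ "vector [s,t]"]) (auto simp: mem_box_cart forall_2)
qed

lemma det_matrix_eq_det2:
  "det (matrix L) = det2 (L (axis 1 1)) (L (axis 2 1))" for L :: "plane \<Rightarrow> plane"
  by (simp add: det_2 matrix_def det2_def)

lemma area_parallelogram_hull: "area (convex hull {a, a + u, a + u + v, a + v}) = \<bar>det2 u v\<bar>"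
proof -
  let ?f = "\<lambda>z::plane. z $ 1 *\<^sub>R u + z $ 2 *\<^sub>R v"
  have lin: "linear ?f"
    by (auto intro!: linearI simp: algebra_simps)
  have "convex hull {a, a + u, a + u + v, a + v} = (+) a ` ?f ` cbox 0 1"
    by (simp add: parallelogram_hull_eq image_image)
  moreover have "?f ` cbox 0 1 \<in> lmeasurable"
    by (intro lmeasurable_compact compact_continuous_image linear_continuous_on compact_cbox)
       (use lin linear_conv_bounded_linear in blast)
  ultimately have "area (convex hull {a, a + u, a + u + v, a + v}) = area (?f ` cbox 0 1)"
    by (simp add: measure_translation)
  also have "\<dots> = \<bar>det2 (?f (axis 1 1)) (?f (axis 2 1))\<bar> * area (cbox 0 1)"
    by (subst measure_linear_image[OF lin]) (auto simp: det_matrix_eq_det2 simp del: det2_linear_simps)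
  also have "?f (axis 1 1) = u" by (simp add: axis_def)
  also have "?f (axis 2 1) = v" by (simp add: axis_def)
  also have "area (cbox 0 (1::plane)) = 1"
    using content_cbox_cart[of 0 "1::plane"] by (simp add: interval_ne_empty_cart)
  finally show ?thesis by simp
qed

lemma area_triangle: "area (convex hull {a, b, c}) = \<bar>det2 (b - a) (c - a)\<bar> / 2"
proof -
  have "convex hull {a, b, c} \<in> sets borel"
    by (intro borel_compact finite_imp_compact_convex_hull) auto
  then have "area (convex hull {a, b, c}) = measure lborel (convex hull {a, b, c})"
    by simp
  then show ?thesis
    unfolding content_triangle det2_def by (simp add: abs_minus_commute algebra_simps)
qed

text \<open>All points of the hull have nonnegative coordinates along \<open>u\<close> and
  \<open>v\<close>, and those of \<open>a\<close> are zero. A convex combination with positive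
  weights can vanish only if both points do, so no proper segment passes through
  \<open>a\<close>.\<close>

lemma vertex_of_parallelogram:
  assumes "det2 u v \<noteq> 0"
  shows "a extreme_point_of (convex hull {a, a + u, a + u + v, a + v})" (is "_ extreme_point_of ?H")
  unfolding extreme_point_of_def
proof (intro conjI ballI)
  show "a \<in> ?H" by (rule hull_inc) simp
  fix x y assume "x \<in> ?H" "y \<in> ?H"
  then obtain s t s' t' where
    st: "0 \<le> s" "0 \<le> t" "x = a + (s *\<^sub>R u + t *\<^sub>R v)" and
    st': "0 \<le> s'" "0 \<le> t'" "y = a + (s' *\<^sub>R u + t' *\<^sub>R v)"
    unfolding parallelogram_hull_iff by blast
  show "a \<notin> open_segment x y"
  proof
    assume "a \<in> open_segment x y"
    then obtain r where r: "0 < r" "r < 1" "x \<noteq> y" "a = (1 - r) *\<^sub>R x + r *\<^sub>R y"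
      by (auto simp: in_segment)
    have "a = a + (((1 - r) * s + r * s') *\<^sub>R u + ((1 - r) * t + r * t') *\<^sub>R v)"
      using r(4) unfolding st(3) st'(3) by (simp add: algebra_simps)
    then have z: "((1 - r) * s + r * s') *\<^sub>R u + ((1 - r) * t + r * t') *\<^sub>R v = 0" (is "?z = 0")
      by simp
    have "det2 ?z v = 0" "det2 u ?z = 0" unfolding z by simp_all
    then have "(1 - r) * s + r * s' = 0" "(1 - r) * t + r * t' = 0" using assms by simp_all
    moreover have "0 \<le> (1 - r) * s" "0 \<le> r * s'" "0 \<le> (1 - r) * t" "0 \<le> r * t'"
      using st(1,2) st'(1,2) r(1,2) by simp_all
    ultimately have "(1 - r) * s = 0" "r * s' = 0" "(1 - r) * t = 0" "r * t' = 0" by linarith+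
    then have "s = 0" "s' = 0" "t = 0" "t' = 0" using r(1,2) by simp_all
    then show False using st(3) st'(3) r(3) by simp
  qed
qed

lemma vertices_parallelogram_hull:
  assumes "det2 u v \<noteq> 0"
  shows "vertices (convex hull {a, a + u, a + u + v, a + v}) = {a, a + u, a + u + v, a + v}"
proof
  show "vertices (convex hull {a, a + u, a + u + v, a + v}) \<subseteq> {a, a + u, a + u + v, a + v}"
    unfolding vertices_def by (rule extreme_points_of_convex_hull)
  \<comment> \<open>Each of the other corners serves as base point once the signs of the edges that
    meet there are adjusted.\<close>
  have "{a, a + u, a + u + v, a + v} = {a + u, a + u + - u, a + u + - u + v, a + u + v}"
    "{a, a + u, a + u + v, a + v} = {a + v, a + v + u, a + v + u + - v, a + v + - v}"
    "{a, a + u, a + u + v, a + v} = {a + u + v, a + u + v + - u, a + u + v + - u + - v, a + u + v + - v}"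
    by (auto simp: algebra_simps)
  then have "(a + u) extreme_point_of (convex hull {a, a + u, a + u + v, a + v})"
    "(a + v) extreme_point_of (convex hull {a, a + u, a + u + v, a + v})"
    "(a + u + v) extreme_point_of (convex hull {a, a + u, a + u + v, a + v})"
    using vertex_of_parallelogram[of "-u" v "a + u"] vertex_of_parallelogram[of u "-v" "a + v"]
      vertex_of_parallelogram[of "-u" "-v" "a + u + v"] assms by simp_all
  then show "{a, a + u, a + u + v, a + v} \<subseteq> vertices (convex hull {a, a + u, a + u + v, a + v})"
    using vertex_of_parallelogram[OF assms] by (auto simp: vertices_def)
qed

lemma parallelogramE:
  assumes "parallelogram P"
  obtains a u v where "det2 u v \<noteq> 0" "P = convex hull {a, a + u, a + u + v, a + v}"
  using assms unfolding parallelogram_def collinear_0_iff_det2 by blast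

lemma parallelogramI: "det2 u v \<noteq> 0 \<Longrightarrow> parallelogram (convex hull {a, a + u, a + u + v, a + v})"
  unfolding parallelogram_def collinear_0_iff_det2 by blast

lemma compact_parallelogram: "parallelogram P \<Longrightarrow> compact P"
  by (auto simp: parallelogram_def intro!: finite_imp_compact_convex_hull)

lemma area_mono: "compact S \<Longrightarrow> compact T \<Longrightarrow> S \<subseteq> T \<Longrightarrow> area S \<le> area T"
  by (intro measure_mono_fmeasurable) (auto simp: lmeasurable_compact fmeasurableD)

lemma area_pos_imp_interior: 
  assumes "convex S" "area S > 0"
  shows "interior S \<noteq> {}"
  using assms by (metis less_irrefl negligible_convex_interior negligible_imp_measure0)

lemma convex_polygon_hull:
  assumes "finite V" "area (convex hull V) > 0"
  shows "convex_polygon (convex hull V)" "card (vertices (convex hull V)) \<le> card V"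
  using assms area_pos_imp_interior[of "convex hull V"] extreme_points_of_convex_hull[of V]
  by (auto simp: convex_polygon_def polytope_def vertices_def intro: card_mono)

lemma convex_polygon_vertices:
  assumes "convex_polygon Q"
  shows "finite (vertices Q)" "convex hull (vertices Q) = Q" "vertices Q \<noteq> {}" "vertices Q \<subseteq> Q"
proof -
  obtain V where V: "finite V" "Q = convex hull V" and int: "interior Q \<noteq> {}"
    using assms by (auto simp: convex_polygon_def polytope_def)
  show "finite (vertices Q)"
    using V extreme_points_of_convex_hull finite_subset unfolding vertices_def by metis
  show hull: "convex hull (vertices Q) = Q"
    unfolding vertices_def using V by (metis Krein_Milman_Minkowski convex_convex_hull finite_imp_compact_convex_hull)
  show "vertices Q \<noteq> {}" using hull int by auto
  show "vertices Q \<subseteq> Q" by (auto simp: vertices_def extreme_point_of_def)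
qed

section \<open>Areas of triangles and quadrilaterals\<close>

lemma set_card_le_3E:
  assumes "finite V" "V \<noteq> {}" "card V \<le> 3"
  obtains a b c where "V = {a, b, c}"
proof -
  have "card V \<noteq> 0" using assms by simp
  with assms(3) consider "card V = 1" | "card V = 2" | "card V = 3" by linarith
  then show thesis
  proof cases
    case 1 then show ?thesis using that by (metis card_1_singletonE insert_absorb2)
  next
    case 2 then show ?thesis using that by (metis card_2_iff insert_absorb2)
  next
    case 3 then show ?thesis using that by (metis card_3_iff)
  qed
qed

text \<open>A point of the hull lies between some \<open>x\<close> on one diagonal and some
  \<open>y\<close> on the other. The crossing point \<open>z\<close> splits the second diagonal, so
  \<open>y\<close> lies on the side of \<open>b\<close> or of \<open>d\<close>, which selects the
  triangle.\<close>

lemma convex_hull_quadrilateral_subset: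
  fixes a b c d z :: plane
  assumes z: "z \<in> closed_segment a c" "z \<in> closed_segment b d"
  shows "convex hull {a, c, b, d} \<subseteq> convex hull {a, c, b} \<union> convex hull {a, c, d}"
proof
  fix w assume "w \<in> convex hull {a, c, b, d}"
  then have "w \<in> convex hull ({a, c} \<union> {b, d})" by (simp add: insert_commute)
  then have "w \<in> convex hull (closed_segment a c \<union> closed_segment b d)"
    using hull_mono[of "{a, c} \<union> {b, d}" "closed_segment a c \<union> closed_segment b d" convex]
    by auto
  then obtain q r x y where r: "0 \<le> r" "r \<le> 1" "q = 1 - r" and x: "x \<in> closed_segment a c"
    and y: "y \<in> closed_segment b d" and w: "w = q *\<^sub>R x + r *\<^sub>R y"
    by (subst (asm) convex_hull_union_two) fastforce+
  have sub: "closed_segment a c \<subseteq> convex hull {a, c, e}" for e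
    unfolding segment_convex_hull by (rule hull_mono) auto
  have conc: "w \<in> convex hull {a, c, e}" if "y \<in> closed_segment e z" for e
  proof -
    have "e \<in> convex hull {a, c, e}" by (rule hull_inc) simp
    then have "closed_segment e z \<subseteq> convex hull {a, c, e}"
      by (meson closed_segment_subset convex_convex_hull sub subsetD z(1))
    then have "y \<in> convex hull {a, c, e}" "x \<in> convex hull {a, c, e}" using that x sub by auto
    then show ?thesis unfolding w using r by (simp add: convexD_alt)
  qed
  have "y \<in> closed_segment b z \<union> closed_segment z d"
    using Un_closed_segment[OF z(2)] y by simp
  then show "w \<in> convex hull {a, c, b} \<union> convex hull {a, c, d}"
    using conc[of b] conc[of d] by (auto simp: closed_segment_commute)
qed

text \<open>The diagonal from \<open>a\<close> to \<open>c\<close> cuts the quadrilateral into two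
  triangles. Since the diagonals cross, \<open>b\<close> and \<open>d\<close> lie on opposite sides
  of it, so the absolute values of the signed areas add up to that of their difference.\<close>

lemma area_crossing_quadrilateral:
  assumes z: "z \<in> closed_segment a c" "z \<in> closed_segment b d"
  shows "area (convex hull {a, c, b, d}) \<le> \<bar>det2 (c - a) (d - b)\<bar> / 2"
proof -
  have cp: "compact (convex hull {a, c, e})" for e by (intro finite_imp_compact_convex_hull) auto
  have "area (convex hull {a, c, b, d}) \<le> area (convex hull {a, c, b} \<union> convex hull {a, c, d})"
    by (intro area_mono convex_hull_quadrilateral_subset[OF z] compact_Un cp finite_imp_compact_convex_hull) auto
  also have "\<dots> \<le> area (convex hull {a, c, b}) + area (convex hull {a, c, d})"
    by (intro measure_Un_le fmeasurableD lmeasurable_compact cp)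
  also have "\<dots> = (\<bar>det2 (c - a) (b - a)\<bar> + \<bar>det2 (c - a) (d - a)\<bar>) / 2"
    by (simp add: area_triangle)
  also have "\<dots> = \<bar>det2 (c - a) (d - b)\<bar> / 2"
  proof -
    define X Y where XY: "X = det2 (c - a) (b - a)" "Y = det2 (c - a) (d - a)"
    obtain s where s: "z = (1 - s) *\<^sub>R a + s *\<^sub>R c" using z(1) by (auto simp: in_segment)
    obtain t where t: "0 \<le> t" "t \<le> 1" "z = (1 - t) *\<^sub>R b + t *\<^sub>R d" using z(2) by (auto simp: in_segment)
    have "det2 (c - a) (z - a) = 0" unfolding s by (simp add: algebra_simps det2_def)
    moreover have "det2 (c - a) (z - a) = (1 - t) * X + t * Y"
      unfolding XY t(3) by (simp add: algebra_simps)
    ultimately have sum: "(1 - t) * X + t * Y = 0" by simp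
    have "X * Y \<le> 0"
    proof (rule ccontr)
      assume "\<not> X * Y \<le> 0"
      then consider "X > 0" "Y > 0" | "X < 0" "Y < 0" by (auto simp: not_le zero_less_mult_iff)
      then show False
      proof cases
        case 1 then show ?thesis using sum t
          by (smt (verit) mult_nonneg_nonneg mult_pos_pos)
      next
        case 2 then show ?thesis using sum t
          by (smt (verit) mult_nonneg_nonpos mult_pos_neg)
      qed
    qed
    then have "\<bar>X\<bar> + \<bar>Y\<bar> = \<bar>Y - X\<bar>" by (smt (verit) mult_neg_neg mult_pos_pos)
    also have "Y - X = det2 (c - a) (d - b)" unfolding XY by (simp add: algebra_simps)
    finally show ?thesis unfolding XY by simp
  qed
  finally show ?thesis .
qed

lemma half_diff_in_symmetric:
  assumes "convex B" "o_symmetric B" "x \<in> B" "y \<in> B"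
  shows "(1/2) *\<^sub>R (x - y) \<in> B"
proof -
  have "- y \<in> B" using assms(2,4) unfolding o_symmetric_def by blast
  then have "(1 - 1/2) *\<^sub>R x + (1/2) *\<^sub>R (- y) \<in> B" using assms by (intro convexD_alt) auto
  then show ?thesis by (simp add: algebra_simps)
qed

text \<open>Half of any difference of points of \<open>B\<close> lies in \<open>B\<close>, so the
  determinant of two differences is at most \<open>4 * D\<close>. Apply this to two sides of a
  triangle or to the two diagonals of a quadrilateral.\<close>

lemma area_quadrilateral_le:
  assumes B: "convex B" "o_symmetric B" and D: "\<And>x y. x \<in> B \<Longrightarrow> y \<in> B \<Longrightarrow> \<bar>det2 x y\<bar> \<le> D"
    and Q: "convex_polygon Q" "Q \<subseteq> B" "card (vertices Q) \<le> 4"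
  shows "area Q \<le> 2 * D"
proof -
  have D': "\<bar>det2 (x - y) (x' - y')\<bar> \<le> 4 * D" if "x \<in> B" "y \<in> B" "x' \<in> B" "y' \<in> B" for x y x' y'
    using D[OF half_diff_in_symmetric[OF B that(1,2)] half_diff_in_symmetric[OF B that(3,4)]]
    unfolding det2_linear_simps(7,8) by (simp del: det2_linear_simps)
  note V = convex_polygon_vertices[OF Q(1)]
  show ?thesis
  proof (cases "card (vertices Q) \<le> 3")
    case True
    then obtain a b c where abc: "vertices Q = {a, b, c}" using V set_card_le_3E by metis
    then have "area Q = \<bar>det2 (b - a) (c - a)\<bar> / 2" using V(2) area_triangle by metis
    moreover have "a \<in> B" "b \<in> B" "c \<in> B" using abc V(4) Q(2) by auto
    ultimately show ?thesis using D'[of b a c a] by simp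
  next
    case False
    with Q(3) have card: "card (vertices Q) = 4" by simp
    \<comment> \<open>Four points of the plane are affinely dependent; the partition from Radon's
      theorem will consist of the two pairs of opposite vertices.\<close>
    have "affine_dependent (vertices Q)"
      by (rule affine_dependent_biggerset) (use V card in auto)
    then obtain M P where MP: "M \<subseteq> vertices Q" "P \<subseteq> vertices Q" "M \<inter> P = {}"
      "convex hull M \<inter> convex hull P \<noteq> {}" by (rule Radon)
    \<comment> \<open>A one-point class would put a vertex into the hull of other vertices, although
      removing an extreme point leaves a convex set.\<close>
    have two: "2 \<le> card M" if "M \<subseteq> vertices Q" "P \<subseteq> vertices Q" "M \<inter> P = {}"
      "convex hull M \<inter> convex hull P \<noteq> {}" for M P
    proof (rule ccontr)
      assume "\<not> 2 \<le> card M"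
      moreover have "finite M" "M \<noteq> {}" using that finite_subset[OF that(1) V(1)] by auto
      ultimately have "card M = 1" by (metis One_nat_def Suc_1 card_0_eq le_SucI le_zero_eq not_less_eq_eq order_antisym)
      then obtain m where m: "M = {m}" by (rule card_1_singletonE)
      then have mP: "m \<in> convex hull P" "m \<notin> P" using that by auto
      have "convex Q" using V(2) convex_convex_hull by metis
      then have "convex (Q - {m})"
        using m that(1) by (auto simp: vertices_def extreme_point_of_stillconvex)
      moreover have "P \<subseteq> Q - {m}" using mP that(2) V(4) by auto
      ultimately have "convex hull P \<subseteq> Q - {m}" by (simp add: hull_minimal)
      then show False using mP by auto
    qed
    have fin: "finite M" "finite P" using finite_subset[OF MP(1) V(1)] finite_subset[OF MP(2) V(1)] by auto
    have "card M + card P \<le> 4"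
      using card card_mono[OF V(1), of "M \<union> P"] card_Un_disjoint[OF fin MP(3)] MP by simp
    moreover have "2 \<le> card M" "2 \<le> card P" using two[of M P] two[of P M] MP by (auto simp: Int_commute)
    ultimately have c2: "card M = 2" "card P = 2" by auto
    then obtain a c b d where ab: "M = {a, c}" "P = {b, d}" by (meson card_2_iff)
    have "M \<union> P = vertices Q"
      using card_subset_eq[OF V(1), of "M \<union> P"] card_Un_disjoint[OF fin MP(3)] MP c2 card by simp
    then have vQ: "vertices Q = {a, c, b, d}" using ab by auto
    obtain z where "z \<in> closed_segment a c" "z \<in> closed_segment b d"
      using MP(4) ab unfolding segment_convex_hull by auto
    then have "area Q \<le> \<bar>det2 (c - a) (d - b)\<bar> / 2"
      using area_crossing_quadrilateral V(2) vQ by metis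
    moreover have "a \<in> B" "b \<in> B" "c \<in> B" "d \<in> B" using vQ V(4) Q(2) by auto
    ultimately show ?thesis using D'[of c a d b] by simp
  qed
qed

lemma area_triangle_in_parallelogram:
  assumes P: "parallelogram P" and Q: "convex_polygon Q" "Q \<subseteq> P" "card (vertices Q) \<le> 3"
  shows "area Q \<le> area P / 2"
proof -
  obtain o' u v where uv: "P = convex hull {o', o' + u, o' + u + v, o' + v}"
    using P by (rule parallelogramE)
  note V = convex_polygon_vertices[OF Q(1)]
  obtain a b c where abc: "vertices Q = {a, b, c}" using V set_card_le_3E Q(3) by metis
  then have "a \<in> P" "b \<in> P" "c \<in> P" using V(4) Q(2) by auto
  then obtain a1 a2 b1 b2 c1 c2 where 
    a: "0 \<le> a1" "a1 \<le> 1" "0 \<le> a2" "a2 \<le> 1" "a = o' + (a1 *\<^sub>R u + a2 *\<^sub>R v)" and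
    b: "0 \<le> b1" "b1 \<le> 1" "0 \<le> b2" "b2 \<le> 1" "b = o' + (b1 *\<^sub>R u + b2 *\<^sub>R v)" and
    c: "0 \<le> c1" "c1 \<le> 1" "0 \<le> c2" "c2 \<le> 1" "c = o' + (c1 *\<^sub>R u + c2 *\<^sub>R v)"
    unfolding uv parallelogram_hull_iff by metis
  define k where "k = (b1 - a1) * (c2 - a2) - (b2 - a2) * (c1 - a1)"
  \<comment> \<open>In this cyclic form \<open>k\<close> is linear in the first coordinates, which
    lie in the unit interval. The three coefficients sum to zero, and their positive parts sum to
    the spread of the second coordinates, at most 1; likewise the negative parts.\<close>
  have k: "k = a1 * (b2 - c2) + b1 * (c2 - a2) + c1 * (a2 - b2)"
    by (simp add: k_def algebra_simps)
  have bnd: "t * r \<le> max 0 r \<and> - (t * r) \<le> max 0 (- r)" if "0 \<le> t" "t \<le> 1" for t r :: real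
  proof -
    have "t * s \<le> max 0 s" for s :: real
      using that mult_left_le_one_le[of s t] mult_nonneg_nonpos[of t s] by (cases "0 \<le> s") auto
    from this[of r] this[of "- r"] show ?thesis by simp
  qed
  have lin: "\<bar>p + q + r\<bar> \<le> 1"
    if "p \<le> max 0 (b2 - c2) \<and> - p \<le> max 0 (- (b2 - c2))"
      "q \<le> max 0 (c2 - a2) \<and> - q \<le> max 0 (- (c2 - a2))"
      "r \<le> max 0 (a2 - b2) \<and> - r \<le> max 0 (- (a2 - b2))" for p q r :: real
    using that a(3,4) b(3,4) c(3,4) by (simp add: max_def abs_le_iff split: if_splits)
  have "\<bar>k\<bar> \<le> 1"
    unfolding k by (rule lin[OF bnd[OF a(1,2)] bnd[OF b(1,2)] bnd[OF c(1,2)]])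
  have "area Q = \<bar>det2 (b - a) (c - a)\<bar> / 2" using V(2) abc area_triangle by metis
  also have "det2 (b - a) (c - a) = k * det2 u v"
    unfolding a(5) b(5) c(5) k_def by (simp add: det2_swap[of v u] algebra_simps)
  also have "\<bar>k * det2 u v\<bar> / 2 \<le> \<bar>det2 u v\<bar> / 2"
    using \<open>\<bar>k\<bar> \<le> 1\<close> by (simp add: abs_mult mult_left_le_one_le)
  finally show ?thesis by (simp add: uv area_parallelogram_hull)
qed

section \<open>Polars and circumscribed parallelograms\<close>

text \<open>For symmetric \<open>B\<close> this is the usual polar body turned by a right angle.
  With the determinant in place of the inner product, unimodular maps commute with taking polars,
  and a set can be compared with its own polar.\<close>

definition det_polar :: "plane set \<Rightarrow> plane set" where
  "det_polar B = {p. \<forall>z\<in>B. \<bar>det2 p z\<bar> \<le> 1}"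

lemma closed_det_polar: "closed (det_polar B)"
proof -
  have "det_polar B = (\<Inter>z\<in>B. {p. \<bar>det2 p z\<bar> \<le> 1})" by (auto simp: det_polar_def)
  moreover have "closed {p. \<bar>det2 p z\<bar> \<le> 1}" for z
    by (intro closed_Collect_le continuous_intros)
  ultimately show ?thesis by auto
qed

lemma convex_det_polar: "convex (det_polar B)"
proof (rule convexI)
  fix x y :: plane and u v :: real
  assume xy: "x \<in> det_polar B" "y \<in> det_polar B" "0 \<le> u" "0 \<le> v" "u + v = 1"
  have "\<bar>det2 (u *\<^sub>R x + v *\<^sub>R y) z\<bar> \<le> 1" if "z \<in> B" for z
  proof -
    have "\<bar>det2 x z\<bar> \<le> 1" "\<bar>det2 y z\<bar> \<le> 1" using xy that by (auto simp: det_polar_def)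
    then have "u * \<bar>det2 x z\<bar> + v * \<bar>det2 y z\<bar> \<le> u * 1 + v * 1"
      using xy by (intro add_mono mult_left_mono) auto
    moreover have "\<bar>u * det2 x z + v * det2 y z\<bar> \<le> u * \<bar>det2 x z\<bar> + v * \<bar>det2 y z\<bar>"
      using xy abs_triangle_ineq[of "u * det2 x z" "v * det2 y z"] by (simp add: abs_mult)
    ultimately show ?thesis using xy by simp
  qed
  then show "u *\<^sub>R x + v *\<^sub>R y \<in> det_polar B" by (simp add: det_polar_def)
qed

lemma o_symmetric_iff: "o_symmetric S \<longleftrightarrow> (\<forall>x\<in>S. - x \<in> S)"
  unfolding o_symmetric_def by (force simp: image_iff)

lemma o_symmetric_det_polar: "o_symmetric (det_polar B)"
  by (simp add: o_symmetric_iff det_polar_def)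

lemma zero_in_interior_det_polar:
  assumes "bounded B"
  shows "0 \<in> interior (det_polar B)"
proof -
  obtain M where M: "M > 0" "\<And>z. z \<in> B \<Longrightarrow> norm z \<le> M" using assms bounded_pos by metis
  have "ball 0 (1/M) \<subseteq> det_polar B"
  proof
    fix p :: plane assume "p \<in> ball 0 (1/M)"
    then have p: "norm p \<le> 1/M" by simp
    have "\<bar>det2 p z\<bar> \<le> 1" if "z \<in> B" for z
    proof -
      have "\<bar>det2 p z\<bar> \<le> norm p * norm z" by (rule abs_det2_le_norm)
      also have "\<dots> \<le> 1/M * M" using p M that by (intro mult_mono) auto
      finally show ?thesis using M by simp
    qed
    then show "p \<in> det_polar B" by (simp add: det_polar_def)
  qed
  then show ?thesis using M by (meson centre_in_ball mem_interior zero_less_divide_1_iff)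
qed

lemma bounded_det_polar:
  assumes "0 \<in> interior B"
  shows "bounded (det_polar B)"
proof -
  obtain e where e: "e > 0" "cball 0 e \<subseteq> B" using assms mem_interior_cball by blast
  have "norm p \<le> 1/e" if p: "p \<in> det_polar B" for p
  proof (cases "p = 0")
    case False
    \<comment> \<open>The quarter turn of \<open>p\<close>, scaled to length \<open>e\<close>: it
      lies in \<open>B\<close>, and its determinant with \<open>p\<close> is
      \<open>e * norm p\<close>.\<close>
    define z where "z = (e / norm p) *\<^sub>R (vector [- p $ 2, p $ 1] :: plane)"
    have nv: "norm (vector [- p $ 2, p $ 1] :: plane) = norm p"
      by (simp add: norm_vec_def L2_set_def sum_2)
    then have "z \<in> B" using e False by (auto simp: z_def)
    then have "\<bar>det2 p z\<bar> \<le> 1" using p by (auto simp: det_polar_def)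
    moreover have "det2 p (vector [- p $ 2, p $ 1]) = (norm p)\<^sup>2"
      by (simp add: det2_def power2_norm_eq_inner inner_vec_def sum_2)
    then have "det2 p z = e * norm p" using False by (simp add: z_def power2_eq_square)
    ultimately show ?thesis using e by (simp add: field_simps)
  qed (use e in simp)
  then show ?thesis by (meson boundedI)
qed

lemma K2o_zero_interior:
  assumes "B \<in> K2o"
  shows "0 \<in> interior B"
proof -
  obtain x where x: "x \<in> interior B" and B: "convex B" "o_symmetric B"
    using assms by (auto simp: K2o_def)
  have "uminus ` interior B = interior (uminus ` B)"
    by (rule interior_bijective_linear_image[symmetric])
       (auto simp: linear_uminus bij_uminus)
  then have "- x \<in> interior B" using x B(2) unfolding o_symmetric_def by (metis imageI)
  then have "(1 - 1/2) *\<^sub>R x + (1/2) *\<^sub>R (- x) \<in> interior B"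
    by (intro convexD_alt convex_interior B x) auto
  then show ?thesis by simp
qed

lemma K2oD:
  assumes "B \<in> K2o"
  shows "compact B" "convex B" "o_symmetric B" "bounded B" "closed B" "0 \<in> B"
  using assms K2o_zero_interior[OF assms] interior_subset
  by (auto simp: K2o_def compact_imp_bounded compact_imp_closed)

lemma det_polar_in_K2o:
  assumes "B \<in> K2o"
  shows "det_polar B \<in> K2o"
  using closed_det_polar convex_det_polar o_symmetric_det_polar bounded_det_polar[OF K2o_zero_interior[OF assms]]
    zero_in_interior_det_polar[OF K2oD(4)[OF assms]]
  by (auto simp: K2o_def compact_eq_bounded_closed)

text \<open>A point outside \<open>B\<close> is separated from it by a line. The functional of this
  line, normalized by symmetry of \<open>B\<close>, is represented by a point of the polar that
  excludes the given point from the bipolar.\<close>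

lemma det_bipolar:
  assumes "B \<in> K2o"
  shows "det_polar (det_polar B) = B"
proof
  show "B \<subseteq> det_polar (det_polar B)"
    unfolding det_polar_def by (auto simp: abs_det2_commute)
  show "det_polar (det_polar B) \<subseteq> B"
  proof (rule ccontr)
    assume "\<not> det_polar (det_polar B) \<subseteq> B"
    then obtain z where z: "z \<in> det_polar (det_polar B)" "z \<notin> B" by auto
    obtain a b where ab: "a \<bullet> z < b" "\<forall>x\<in>B. b < a \<bullet> x"
      using separating_hyperplane_closed_point[OF K2oD(2,5)[OF assms] z(2)] by blast
    have b: "b < 0" using ab(2) K2oD(6)[OF assms] by force
    \<comment> \<open>The quarter turn of the normal vector, chosen so that \<open>det2 p x\<close>
      equals \<open>a \<bullet> x / b\<close>.\<close>
    define p :: plane where "p = (1/b) *\<^sub>R vector [a $ 2, - a $ 1]"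
    have p: "det2 p x = a \<bullet> x / b" for x
      unfolding p_def det2_linear_simps by (simp add: det2_def inner_vec_def sum_2 add_divide_distrib add.commute)
    have "\<bar>det2 p x\<bar> \<le> 1" if "x \<in> B" for x
    proof -
      have "- x \<in> B" using that K2oD(3)[OF assms] by (simp add: o_symmetric_iff)
      then have "b < a \<bullet> x" "a \<bullet> x < - b" using ab(2) that by force+
      then have "\<bar>a \<bullet> x\<bar> \<le> \<bar>b\<bar>" using b by auto
      then show ?thesis using b unfolding p by (simp add: field_simps)
    qed
    then have "p \<in> det_polar B" by (simp add: det_polar_def)
    then have "\<bar>det2 z p\<bar> \<le> 1" using z(1) unfolding det_polar_def by blast
    then have "\<bar>det2 p z\<bar> \<le> 1" by (simp add: det2_swap[of z p])
    then have "\<bar>a \<bullet> z\<bar> \<le> \<bar>b\<bar>" using b unfolding p by (simp add: field_simps)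
    then show False using ab(1) b by auto
  qed
qed

lemma det2_attains_max:
  assumes "compact S" "S \<noteq> {}"
  obtains p q where "p \<in> S" "q \<in> S" "\<And>x y. x \<in> S \<Longrightarrow> y \<in> S \<Longrightarrow> \<bar>det2 x y\<bar> \<le> det2 p q"
proof -
  have "continuous_on (S \<times> S) (\<lambda>z. det2 (fst z) (snd z))" by (intro continuous_intros)
  then obtain z where z: "z \<in> S \<times> S" "\<forall>w\<in>S \<times> S. det2 (fst w) (snd w) \<le> det2 (fst z) (snd z)"
    using continuous_attains_sup[OF compact_Times[OF assms(1) assms(1)]] assms(2) by blast
  have "\<bar>det2 x y\<bar> \<le> det2 (fst z) (snd z)" if "x \<in> S" "y \<in> S" for x y
    using z(2)[rule_format, of "(x, y)"] z(2)[rule_format, of "(y, x)"] that det2_swap[of x y] by auto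
  then show ?thesis using z(1) that by (auto simp: mem_Times_iff)
qed

lemma K2o_det2_pos:
  assumes "B \<in> K2o"
  obtains p q where "p \<in> B" "q \<in> B" "det2 p q > 0"
proof -
  obtain e where e: "e > 0" "cball 0 e \<subseteq> B" using K2o_zero_interior[OF assms] mem_interior_cball by blast
  have "e *\<^sub>R axis 1 1 \<in> B" "e *\<^sub>R axis 2 1 \<in> B" using e by auto
  moreover have "det2 (e *\<^sub>R axis 1 1) (e *\<^sub>R axis 2 1) > 0" using e
    by (simp add: det2_def axis_def)
  ultimately show ?thesis using that by blast
qed

section \<open>Minimum area circumscribed parallelograms through the polar\<close>

lemma circumscribed_area_from_polar:
  assumes "o_symmetric B" "parallelogram P" "B \<subseteq> P"
  obtains x y where "x \<in> det_polar B" "y \<in> det_polar B" "det2 x y > 0" "area P = 4 / det2 x y"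
proof -
  obtain a u v where uv: "det2 u v \<noteq> 0" "P = convex hull {a, a + u, a + u + v, a + v}"
    using assms(2) by (rule parallelogramE)
  define d where "d = \<bar>det2 u v\<bar>"
  have d: "d > 0" using uv by (simp add: d_def)
  have zb: "\<bar>det2 v z\<bar> \<le> d / 2 \<and> \<bar>det2 u z\<bar> \<le> d / 2" if "z \<in> B" for z
  proof -
    \<comment> \<open>\<open>P\<close> may be off centre. Subtracting the representations of
      \<open>z\<close> and \<open>- z\<close> removes the base point and leaves coordinates between
      -1 and 1 for \<open>2 *\<^sub>R z\<close>.\<close>
    have "z \<in> P" "- z \<in> P" using that assms by (auto simp: o_symmetric_iff)
    then obtain s t s' t' where
      z: "0 \<le> s" "s \<le> 1" "0 \<le> t" "t \<le> 1" "z = a + (s *\<^sub>R u + t *\<^sub>R v)" and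
      z': "0 \<le> s'" "s' \<le> 1" "0 \<le> t'" "t' \<le> 1" "- z = a + (s' *\<^sub>R u + t' *\<^sub>R v)"
      unfolding uv parallelogram_hull_iff by blast
    have "2 *\<^sub>R z = (s - s') *\<^sub>R u + (t - t') *\<^sub>R v"
    proof -
      have "2 *\<^sub>R z = z - (- z)" by (simp add: scaleR_2)
      also have "\<dots> = (s - s') *\<^sub>R u + (t - t') *\<^sub>R v" by (subst z', subst z) (simp add: algebra_simps)
      finally show ?thesis .
    qed
    then have "det2 v (2 *\<^sub>R z) = det2 v ((s - s') *\<^sub>R u + (t - t') *\<^sub>R v)"
      "det2 u (2 *\<^sub>R z) = det2 u ((s - s') *\<^sub>R u + (t - t') *\<^sub>R v)" by simp_all
    then have "2 * det2 v z = (s - s') * det2 v u" "2 * det2 u z = (t - t') * det2 u v" by simp_all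
    then have "2 * \<bar>det2 v z\<bar> = \<bar>s - s'\<bar> * d" "2 * \<bar>det2 u z\<bar> = \<bar>t - t'\<bar> * d"
      unfolding d_def by (metis abs_mult abs_numeral abs_minus_cancel det2_swap)+
    moreover have "\<bar>s - s'\<bar> * d \<le> d" "\<bar>t - t'\<bar> * d \<le> d"
      using z(1-4) z'(1-4) d by (simp_all add: mult_left_le_one_le)
    ultimately show ?thesis by linarith
  qed
  define p q where pq: "p = (2/d) *\<^sub>R u" "q = (2/d) *\<^sub>R v"
  have mem: "p \<in> det_polar B" "q \<in> det_polar B"
    using zb d by (auto simp: pq det_polar_def abs_mult field_simps)
  have dpq: "\<bar>det2 p q\<bar> = 4 / d" unfolding pq using d by (simp add: abs_mult d_def field_simps)
  have area: "area P = d" by (simp add: uv area_parallelogram_hull d_def)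
  show thesis
  proof (cases "det2 p q > 0")
    case True
    then show ?thesis using that[OF mem] dpq area d by simp
  next
    case False
    then have "det2 q p = 4 / d" using dpq det2_swap[of q p] by simp
    then show ?thesis using that[OF mem(2,1)] area d by simp
  qed
qed

lemma circumscribed_from_polar:
  assumes "p \<in> det_polar B" "q \<in> det_polar B" "det2 p q > 0"
  obtains P where "parallelogram P" "B \<subseteq> P" "area P = 4 / det2 p q"
proof -
  define d where "d = det2 p q"
  \<comment> \<open>The intersection of the strips \<open>\<bar>det2 p z\<bar> \<le> 1\<close> and
    \<open>\<bar>det2 q z\<bar> \<le> 1\<close>: its edges are parallel to \<open>p\<close> and
    \<open>q\<close>, and \<open>a\<close> is the corner that centres it at the origin.\<close>
  define a u v where auv: "a = (- 1/d) *\<^sub>R (p + q)" "u = (2/d) *\<^sub>R p" "v = (2/d) *\<^sub>R q"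
  have d: "d > 0" using assms by (simp add: d_def)
  have uv: "det2 u v = 4 / d" unfolding auv using d by (simp add: d_def field_simps)
  have "B \<subseteq> convex hull {a, a + u, a + u + v, a + v}"
  proof
    fix z assume "z \<in> B"
    then have b: "\<bar>det2 p z\<bar> \<le> 1" "\<bar>det2 q z\<bar> \<le> 1" using assms by (auto simp: det_polar_def)
    have dz: "d *\<^sub>R z = det2 z q *\<^sub>R p + det2 p z *\<^sub>R q" unfolding d_def by (rule det2_scaled_identity)
    have "z = (1/d) *\<^sub>R (d *\<^sub>R z)" using d by simp
    also have "\<dots> = a + (((1 + det2 z q) / 2) *\<^sub>R u + ((1 + det2 p z) / 2) *\<^sub>R v)"
      unfolding dz auv by (simp add: algebra_simps add_divide_distrib)
    finally have "z = a + (((1 + det2 z q) / 2) *\<^sub>R u + ((1 + det2 p z) / 2) *\<^sub>R v)" .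
    moreover have "\<bar>det2 z q\<bar> \<le> 1" using b det2_swap[of z q] by simp
    ultimately show "z \<in> convex hull {a, a + u, a + u + v, a + v}"
      unfolding parallelogram_hull_iff using b
      by (intro exI[of _ "(1 + det2 z q) / 2"] exI[of _ "(1 + det2 p z) / 2"]) auto
  qed
  moreover have "parallelogram (convex hull {a, a + u, a + u + v, a + v})"
    using uv d by (intro parallelogramI) simp
  moreover have "area (convex hull {a, a + u, a + u + v, a + v}) = 4 / d"
    unfolding area_parallelogram_hull uv using d by simp
  ultimately show ?thesis using that unfolding d_def by blast
qed

text \<open>Pairs in the polar and circumscribed parallelograms bound each other through
  \<open>4 / det2 p q\<close>, so a maximal pair gives a minimal area. This also shows that the
  choice in \<open>min_circ\<close> picks an actual minimizer.\<close>

lemma min_circ_area_eq_max_polar: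
  assumes B: "B \<in> K2o" and pq: "p \<in> det_polar B" "q \<in> det_polar B"
    and max: "\<And>x y. x \<in> det_polar B \<Longrightarrow> y \<in> det_polar B \<Longrightarrow> \<bar>det2 x y\<bar> \<le> det2 p q"
  shows "det2 p q > 0" "min_circumscribed_parallelogram B (min_circ B)" "area (min_circ B) = 4 / det2 p q"
proof -
  obtain x y where "x \<in> det_polar B" "y \<in> det_polar B" "det2 x y > 0"
    using K2o_det2_pos[OF det_polar_in_K2o[OF B]] by metis
  then show pos: "det2 p q > 0" using max[of x y] by simp
  obtain P where P: "parallelogram P" "B \<subseteq> P" "area P = 4 / det2 p q"
    using circumscribed_from_polar[OF pq pos] .
  have ge: "4 / det2 p q \<le> area P'" if P': "parallelogram P'" "B \<subseteq> P'" for P'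
  proof -
    obtain x y where xy: "x \<in> det_polar B" "y \<in> det_polar B" "det2 x y > 0" "area P' = 4 / det2 x y"
      using circumscribed_area_from_polar[OF K2oD(3)[OF B] P'] .
    then show ?thesis using max[of x y] by (simp add: divide_left_mono)
  qed
  then have "min_circumscribed_parallelogram B P" using P by (simp add: min_circumscribed_parallelogram_def)
  then show mc: "min_circumscribed_parallelogram B (min_circ B)" unfolding min_circ_def by (rule someI)
  show "area (min_circ B) = 4 / det2 p q"
    using mc P ge unfolding min_circumscribed_parallelogram_def by (metis order_antisym)
qed

lemma min_circ_props:
  assumes "B \<in> K2o"
  shows "min_circumscribed_parallelogram B (min_circ B)" "area (min_circ B) > 0"
    "parallelogram (min_circ B)" "B \<subseteq> min_circ B"
proof -
  obtain p q where "p \<in> det_polar B" "q \<in> det_polar B"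
    "\<And>x y. x \<in> det_polar B \<Longrightarrow> y \<in> det_polar B \<Longrightarrow> \<bar>det2 x y\<bar> \<le> det2 p q"
    using det2_attains_max[of "det_polar B"] K2oD(1,6)[OF det_polar_in_K2o[OF assms]] by (metis empty_iff)
  from min_circ_area_eq_max_polar[OF assms this]
  show "min_circumscribed_parallelogram B (min_circ B)" "area (min_circ B) > 0"
    "parallelogram (min_circ B)" "B \<subseteq> min_circ B"
    by (auto simp: min_circumscribed_parallelogram_def)
qed

section \<open>Inscribed polygons\<close>

definition polygons :: "nat \<Rightarrow> plane set \<Rightarrow> plane set set" where
  "polygons n B = {Q. convex_polygon Q \<and> Q \<subseteq> B \<and> card (vertices Q) \<le> n}"

lemma mu_mstar_polygons: "mu_mstar n B = (SUP Q\<in>polygons n B. vol_mstar B Q)"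
  unfolding mu_mstar_def polygons_def by (simp add: image_Collect conj_commute)

lemma compact_convex_polygon: "convex_polygon Q \<Longrightarrow> compact Q"
  by (simp add: convex_polygon_def polytope_imp_compact)


lemma polygons_nonempty:
  assumes B: "B \<in> K2o" and "3 \<le> n"
  shows "polygons n B \<noteq> {}"
proof -
  obtain p q where pq: "p \<in> B" "q \<in> B" "det2 p q > 0" using K2o_det2_pos[OF B] .
  let ?T = "convex hull {0, p, q}"
  have "area ?T > 0" using pq by (simp add: area_triangle)
  then have "convex_polygon ?T" "card (vertices ?T) \<le> card {0, p, q}" by (auto intro: convex_polygon_hull)
  moreover have "card {0, p, q} \<le> 3" by (simp add: card_insert_if)
  moreover have "?T \<subseteq> B" using pq K2oD[OF B] by (simp add: hull_minimal)
  ultimately have "?T \<in> polygons n B" using assms(2) by (auto simp: polygons_def)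
  then show ?thesis by blast
qed

text \<open>Besides the bound itself, this makes the supremum in \<open>mu_mstar\<close> one of a
  bounded family.\<close>

lemma vol_mstar_le_4:
  assumes B: "B \<in> K2o" and Q: "Q \<in> polygons n B"
  shows "vol_mstar B Q \<le> 4"
proof -
  have "area Q \<le> area (min_circ B)"
    using Q min_circ_props[OF B]
    by (intro area_mono) (auto simp: polygons_def compact_parallelogram compact_convex_polygon)
  then show ?thesis using min_circ_props(2)[OF B] by (simp add: vol_mstar_def field_simps)
qed

lemma mu_mstar_upper:
  assumes "B \<in> K2o" "Q \<in> polygons n B"
  shows "4 * area Q / area (min_circ B) \<le> mu_mstar n B"
  unfolding mu_mstar_polygons vol_mstar_def[symmetric]
  by (rule cSUP_upper[OF assms(2)]) (auto intro!: bdd_aboveI2[of _ _ 4] vol_mstar_le_4[OF assms(1)])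

lemma mu_mstar_least:
  assumes "B \<in> K2o" "3 \<le> n" "\<And>Q. Q \<in> polygons n B \<Longrightarrow> 4 * area Q / area (min_circ B) \<le> c"
  shows "mu_mstar n B \<le> c"
  unfolding mu_mstar_polygons vol_mstar_def
  by (rule cSUP_least[OF polygons_nonempty[OF assms(1,2)] assms(3)])

lemma mu_mstar_nonneg:
  assumes "B \<in> K2o" "3 \<le> n"
  shows "0 \<le> mu_mstar n B"
proof -
  obtain Q where Q: "Q \<in> polygons n B" using polygons_nonempty[OF assms] by auto
  have "0 \<le> 4 * area Q / area (min_circ B)" by simp
  then show ?thesis using mu_mstar_upper[OF assms(1) Q] by (rule order_trans)
qed

lemma mu_mstar_le_4: "B \<in> K2o \<Longrightarrow> 3 \<le> n \<Longrightarrow> mu_mstar n B \<le> 4"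
  using mu_mstar_least vol_mstar_le_4 unfolding vol_mstar_def by blast

lemma mu_mstar_3_le_2: 
  assumes "B \<in> K2o" 
  shows "mu_mstar 3 B \<le> 2"
proof (rule mu_mstar_least[OF assms])
  fix Q assume "Q \<in> polygons 3 B"
  then have "area Q \<le> area (min_circ B) / 2"
    using min_circ_props[OF assms] by (intro area_triangle_in_parallelogram) (auto simp: polygons_def)
  then show "4 * area Q / area (min_circ B) \<le> 2" using min_circ_props(2)[OF assms] by (simp add: field_simps)
qed simp

lemma area_min_circ_parallelogram:
  assumes B: "B \<in> K2o" "parallelogram B"
  shows "area (min_circ B) = area B"
proof (rule antisym)
  show "area (min_circ B) \<le> area B"
    using min_circ_props(1)[OF B(1)] B by (auto simp: min_circumscribed_parallelogram_def)
  show "area B \<le> area (min_circ B)"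
    using min_circ_props[OF B(1)] B compact_parallelogram by (intro area_mono) auto
qed

text \<open>Half of \<open>B\<close>, cut off by a diagonal, is a competitor among triangles, and
  \<open>B\<close> itself is one among quadrilaterals.\<close>

lemma mu_mstar_parallelogram:
  assumes B: "B \<in> K2o" "parallelogram B"
  shows "2 \<le> mu_mstar 3 B" "4 \<le> n \<Longrightarrow> 4 \<le> mu_mstar n B"
proof -
  obtain a u v where uv: "det2 u v \<noteq> 0" "B = convex hull {a, a + u, a + u + v, a + v}"
    using B(2) by (rule parallelogramE)
  have area: "area (min_circ B) = \<bar>det2 u v\<bar>"
    using area_min_circ_parallelogram[OF B] by (simp add: uv area_parallelogram_hull)
  let ?T = "convex hull {a, a + u, a + v}"
  have T: "area ?T = \<bar>det2 u v\<bar> / 2" by (simp add: area_triangle)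
  then have "convex_polygon ?T" "card (vertices ?T) \<le> card {a, a + u, a + v}"
    using uv by (auto intro: convex_polygon_hull)
  moreover have "card {a, a + u, a + v} \<le> 3" by (simp add: card_insert_if)
  moreover have "?T \<subseteq> B" unfolding uv by (rule hull_mono) auto
  ultimately have "?T \<in> polygons 3 B" by (auto simp: polygons_def)
  from mu_mstar_upper[OF B(1) this] show "2 \<le> mu_mstar 3 B" unfolding T area using uv by simp
  have aB: "area B = \<bar>det2 u v\<bar>" unfolding uv by (rule area_parallelogram_hull)
  have "convex_polygon B" "card (vertices B) \<le> card {a, a + u, a + u + v, a + v}"
    using convex_polygon_hull[of "{a, a + u, a + u + v, a + v}"] aB uv by auto
  moreover have "card {a, a + u, a + u + v, a + v} \<le> 4" by (simp add: card_insert_if)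
  ultimately have "B \<in> polygons n B" if "4 \<le> n" using that by (auto simp: polygons_def)
  from mu_mstar_upper[OF B(1) this] show "4 \<le> mu_mstar n B" if "4 \<le> n" using that uv unfolding aB area by simp
qed

section \<open>Self-polar sets\<close>

lemma self_polar_in_K2o:
  assumes "bounded K" "det_polar K = K"
  shows "K \<in> K2o"
  using closed_det_polar[of K] convex_det_polar[of K] o_symmetric_det_polar[of K]
    zero_in_interior_det_polar[OF assms(1)] assms
  by (auto simp: K2o_def compact_eq_bounded_closed)

text \<open>A maximal set with \<open>\<bar>det2\<bar> \<le> 1\<close> pairwise is self-polar because \<open>det2 z z = 0\<close>: a point of its polar
  can always be added.\<close>

lemma self_polar_extension:
  assumes E: "\<And>x y. x \<in> E \<Longrightarrow> y \<in> E \<Longrightarrow> \<bar>det2 x y\<bar> \<le> 1"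
  obtains K where "E \<subseteq> K" "det_polar K = K"
proof -
  \<comment> \<open>\<open>K \<union> E\<close> instead of \<open>E \<subseteq> K\<close>, so that the union of the empty chain belongs to \<open>A\<close>.\<close>
  define A where "A = {K. \<forall>x\<in>K \<union> E. \<forall>y\<in>K \<union> E. \<bar>det2 x y\<bar> \<le> 1}"
  have "\<Union>C \<in> A" if "subset.chain A C" for C
  proof -
    have total: "X \<subseteq> Y \<or> Y \<subseteq> X" if "X \<in> C" "Y \<in> C" for X Y
      using \<open>subset.chain A C\<close> that by (auto simp: subset_chain_def)
    have CA: "C \<subseteq> A" using that by (auto simp: subset_chain_def)
    have "\<bar>det2 x y\<bar> \<le> 1" if xy: "x \<in> \<Union>C \<union> E" "y \<in> \<Union>C \<union> E" for x y
    proof (cases "x \<in> \<Union>C")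
      case True
      then obtain X where X: "X \<in> C" "x \<in> X" by auto
      show ?thesis
      proof (cases "y \<in> \<Union>C")
        case True
        then obtain Y where Y: "Y \<in> C" "y \<in> Y" by auto
        with X total obtain Z where "Z \<in> C" "x \<in> Z" "y \<in> Z" by blast
        then show ?thesis using CA unfolding A_def by blast
      next
        case False
        then show ?thesis using xy X CA unfolding A_def by blast
      qed
    next
      case False
      then have "x \<in> E" using xy by blast
      show ?thesis
      proof (cases "y \<in> E")
        case True then show ?thesis using E \<open>x \<in> E\<close> by blast
      next
        case False
        then obtain Y where "Y \<in> C" "y \<in> Y" using xy by auto
        then show ?thesis using CA \<open>x \<in> E\<close> unfolding A_def by blast
      qed
    qed
    then show ?thesis unfolding A_def by blast
  qed
  then obtain M where M: "M \<in> A" "\<forall>X\<in>A. M \<subseteq> X \<longrightarrow> X = M" using subset_Zorn'[of A] by blast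
  \<comment> \<open>Membership in \<open>A\<close> depends on a set only through its union with
    \<open>E\<close>, so a maximal element already contains \<open>E\<close>.\<close>
  have "M \<union> E \<in> A" using M(1) unfolding A_def by auto
  then have EM: "E \<subseteq> M" using M(2) by blast
  have "det_polar M = M"
  proof
    show "M \<subseteq> det_polar M" using M(1) unfolding A_def det_polar_def by blast
    show "det_polar M \<subseteq> M"
    proof
      fix z assume "z \<in> det_polar M"
      then have z: "\<bar>det2 z x\<bar> \<le> 1" "\<bar>det2 x z\<bar> \<le> 1" if "x \<in> M" for x
        using that abs_det2_commute[of x z] by (auto simp: det_polar_def)
      have "\<bar>det2 x y\<bar> \<le> 1" if "x \<in> insert z M" "y \<in> insert z M" for x y
        using that z M(1) unfolding A_def by auto
      then have "insert z M \<in> A" using EM unfolding A_def by (simp add: Un_absorb2 subset_insertI2)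
      then show "z \<in> M" using M(2) by blast
    qed
  qed
  then show thesis using that EM by blast
qed

text \<open>The polar scaled by \<open>c\<close> has pairwise determinants at most 1 in absolute
  value and extends to a self-polar \<open>K\<close>. Polarity reverses this inclusion, so
  \<open>K\<close> lies in the polar of the scaled polar, which is \<open>B\<close> scaled by
  \<open>1/c\<close>.\<close>

lemma self_polar_inside:
  assumes B: "B \<in> K2o"
  obtains K c where "K \<in> K2o" "det_polar K = K" "c > 0" "(*\<^sub>R) c ` K \<subseteq> B" "area (min_circ B) = 4 * c\<^sup>2"
proof -
  obtain p q where pq: "p \<in> det_polar B" "q \<in> det_polar B"
    and max: "\<And>x y. x \<in> det_polar B \<Longrightarrow> y \<in> det_polar B \<Longrightarrow> \<bar>det2 x y\<bar> \<le> det2 p q"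
    using det2_attains_max[of "det_polar B"] K2oD(1,6)[OF det_polar_in_K2o[OF B]] by (metis empty_iff)
  note mc = min_circ_area_eq_max_polar[OF B pq max]
  \<comment> \<open>Determinants scale by \<open>c\<^sup>2\<close>, so the maximum over the polar
    becomes 1.\<close>
  define c where "c = 1 / sqrt (det2 p q)"
  have c: "c > 0" "c * c = 1 / det2 p q" using mc(1) by (auto simp: c_def)
  have "\<bar>det2 x y\<bar> \<le> 1" if xy: "x \<in> (*\<^sub>R) c ` det_polar B" "y \<in> (*\<^sub>R) c ` det_polar B" for x y
  proof -
    obtain x' y' where "x = c *\<^sub>R x'" "y = c *\<^sub>R y'" "x' \<in> det_polar B" "y' \<in> det_polar B" using xy by auto
    then have "\<bar>det2 x y\<bar> = (c * c) * \<bar>det2 x' y'\<bar>" "\<bar>det2 x' y'\<bar> \<le> det2 p q"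
      using c(1) max by (auto simp: abs_mult)
    then show ?thesis using mc(1) unfolding c(2) by simp
  qed
  then obtain K where K: "(*\<^sub>R) c ` det_polar B \<subseteq> K" "det_polar K = K"
    using self_polar_extension by metis
  have sub: "c *\<^sub>R z \<in> B" if "z \<in> K" for z
  proof -
    have "\<bar>det2 z (c *\<^sub>R x)\<bar> \<le> 1" if "x \<in> det_polar B" for x
      using \<open>z \<in> K\<close> K that unfolding det_polar_def by blast
    then have "c *\<^sub>R z \<in> det_polar (det_polar B)" by (simp add: det_polar_def)
    then show ?thesis using det_bipolar[OF B] by simp
  qed
  have "K \<subseteq> (*\<^sub>R) (1/c) ` B"
  proof
    fix z assume "z \<in> K"
    then have "z = (1/c) *\<^sub>R (c *\<^sub>R z)" "c *\<^sub>R z \<in> B" using sub c by auto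
    then show "z \<in> (*\<^sub>R) (1/c) ` B" by blast
  qed
  then have "bounded K" using K2oD(4)[OF B] bounded_scaling bounded_subset by blast
  then have "K \<in> K2o" using K(2) by (rule self_polar_in_K2o)
  moreover have "area (min_circ B) = 4 * c\<^sup>2" using mc(3) unfolding power2_eq_square c(2) by simp
  ultimately show thesis using that[of K c] K(2) c(1) sub by blast
qed

lemma mem_interior_if_dilate:
  assumes "K \<in> K2o" "1 < t" "t *\<^sub>R x \<in> K"
  shows "x \<in> interior K"
proof -
  have "t *\<^sub>R x - (1 - 1/t) *\<^sub>R (t *\<^sub>R x - 0) \<in> interior K"
    by (rule mem_interior_convex_shrink[OF K2oD(2)[OF assms(1)] K2o_zero_interior[OF assms(1)] assms(3)])
       (use assms(2) in auto)
  moreover have "t *\<^sub>R x - (1 - 1/t) *\<^sub>R (t *\<^sub>R x - 0) = x"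
    using assms(2) by (simp add: algebra_simps)
  ultimately show ?thesis by simp
qed

text \<open>If \<open>det2 x\<close> had maximum below 1 on \<open>K\<close>, a proper dilate of
  \<open>x\<close> would still lie in the polar, which is \<open>K\<close>, and \<open>x\<close>
  would be interior.\<close>

lemma self_polar_frontier_partner:
  assumes K: "K \<in> K2o" "det_polar K = K" and x: "x \<in> frontier K"
  obtains y where "y \<in> K" "det2 x y = 1"
proof -
  have xK: "x \<in> K" "x \<notin> interior K" using x K2oD(5)[OF K(1)] by (auto simp: frontier_def)
  have "continuous_on K (\<lambda>y. det2 x y)" by (intro continuous_intros)
  then obtain y where y: "y \<in> K" "\<forall>z\<in>K. det2 x z \<le> det2 x y"
    using continuous_attains_sup[OF K2oD(1)[OF K(1)]] K2oD(6)[OF K(1)] by blast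
  define m where "m = det2 x y"
  have m0: "0 \<le> m" using y K2oD(6)[OF K(1)] unfolding m_def by force
  have "\<bar>det2 x y\<bar> \<le> 1" using xK(1) y(1) K(2) unfolding det_polar_def by blast
  then have m1: "m \<le> 1" by (simp add: m_def)
  have "m = 1"
  proof (rule ccontr)
    assume "m \<noteq> 1"
    \<comment> \<open>A factor above 1 with \<open>t * m \<le> 1\<close> that is also defined for
      \<open>m = 0\<close>.\<close>
    define t where "t = 2 / (1 + m)"
    have t: "1 < t" "t * m \<le> 1" using m0 m1 \<open>m \<noteq> 1\<close> by (auto simp: t_def field_simps)
    have "\<bar>det2 (t *\<^sub>R x) z\<bar> \<le> 1" if "z \<in> K" for z
    proof -
      have "- z \<in> K" using that K2oD(3)[OF K(1)] by (simp add: o_symmetric_iff)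
      then have "\<bar>det2 x z\<bar> \<le> m" using y(2) that unfolding m_def by (force simp: abs_le_iff)
      then have "t * \<bar>det2 x z\<bar> \<le> t * m" using t(1) by (intro mult_left_mono) auto
      also have "\<dots> \<le> 1" by (rule t(2))
      finally show ?thesis using t(1) by (simp add: abs_mult)
    qed
    then have "t *\<^sub>R x \<in> K" using K(2) unfolding det_polar_def by blast
    then show False using mem_interior_if_dilate[OF K(1) t(1)] xK(2) by blast
  qed
  then show thesis using that y(1) m_def by simp
qed

lemma frontier_nonempty_K2o: "B \<in> K2o \<Longrightarrow> frontier B \<noteq> {}"
  using K2oD(4,6) not_bounded_UNIV by (metis empty_iff frontier_eq_empty)

lemma self_polar_unit_pair:
  assumes K: "K \<in> K2o" "det_polar K = K"
  obtains p q where "p \<in> K" "q \<in> K" "det2 p q = 1"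
proof -
  obtain x where x: "x \<in> frontier K" using frontier_nonempty_K2o[OF K(1)] by blast
  then have "x \<in> K" using K2oD(5)[OF K(1)] by (auto simp: frontier_def)
  then show ?thesis using self_polar_frontier_partner[OF K x] that by metis
qed

lemma self_polar_abs_det2_le: "det_polar K = K \<Longrightarrow> x \<in> K \<Longrightarrow> y \<in> K \<Longrightarrow> \<bar>det2 x y\<bar> \<le> 1"
  unfolding det_polar_def by blast

lemma area_min_circ_self_polar:
  assumes K: "K \<in> K2o" "det_polar K = K"
  shows "area (min_circ K) = 4"
proof -
  obtain p q where pq: "p \<in> K" "q \<in> K" "det2 p q = 1" using self_polar_unit_pair[OF K] .
  have "area (min_circ K) = 4 / det2 p q"
    by (rule min_circ_area_eq_max_polar(3)[OF K(1)])
       (use K(2) pq self_polar_abs_det2_le[OF K(2)] in auto)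
  then show ?thesis using pq by simp
qed

section \<open>Transport of polygons and reduction to self-polar sets\<close>

lemma polygons_linear_image:
  assumes L: "linear L" and d: "\<And>x y. det2 (L x) (L y) = d * det2 x y" "d \<noteq> 0" 
    and Q: "Q \<in> polygons n B" and B': "L ` B \<subseteq> B'"
  shows "L ` Q \<in> polygons n B'" "area (L ` Q) = \<bar>d\<bar> * area Q"
proof -
  have Q': "convex_polygon Q" "Q \<subseteq> B" "card (vertices Q) \<le> n" using Q by (auto simp: polygons_def)
  note V = convex_polygon_vertices[OF Q'(1)]
  have "det (matrix L) = d" unfolding det_matrix_eq_det2 d(1) by (simp add: det2_def axis_def)
  then show "area (L ` Q) = \<bar>d\<bar> * area Q"
    using compact_convex_polygon[OF Q'(1)] by (subst measure_linear_image[OF L]) (auto simp: lmeasurable_compact)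
  \<comment> \<open>Points are determined by their determinants with the two axes, and
    \<open>L\<close> keeps these up to the nonzero factor \<open>d\<close>.\<close>
  have "inj L"
  proof (rule injI)
    fix x y assume "L x = L y"
    then have "d * det2 x z = d * det2 y z" for z using d(1) by metis
    then have *: "det2 x z = det2 y z" for z using d(2) by simp
    from *[of "axis 2 1"] *[of "axis 1 1"] show "x = y" by (simp add: plane_eq_iff det2_def axis_def)
  qed
  then have "interior (L ` Q) \<noteq> {}"
    using Q'(1) by (simp add: interior_injective_linear_image L convex_polygon_def)
  then have "convex_polygon (L ` Q)" using Q'(1) L by (simp add: convex_polygon_def polytope_linear_image)
  moreover have "card (vertices (L ` Q)) \<le> n"
  proof -
    have "L ` Q = convex hull (L ` vertices Q)" using V(2) convex_hull_linear_image[OF L] by metis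
    then have "vertices (L ` Q) \<subseteq> L ` vertices Q"
      unfolding vertices_def using extreme_points_of_convex_hull by metis
    then have "card (vertices (L ` Q)) \<le> card (L ` vertices Q)" using V(1) by (intro card_mono) auto
    also have "\<dots> \<le> card (vertices Q)" by (rule card_image_le[OF V(1)])
    finally show ?thesis using Q'(3) by simp
  qed
  ultimately show "L ` Q \<in> polygons n B'" using Q'(2) B' by (auto simp: polygons_def)
qed

lemma polygons_dilate:
  assumes Q: "Q \<in> polygons n B" and c: "c > 0" and B': "(*\<^sub>R) c ` B \<subseteq> B'"
  shows "(*\<^sub>R) c ` Q \<in> polygons n B'" "area ((*\<^sub>R) c ` Q) = c\<^sup>2 * area Q"
proof -
  have L: "linear ((*\<^sub>R) c :: plane \<Rightarrow> plane)" by (rule linear_scaleR)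
  have d: "det2 (c *\<^sub>R x) (c *\<^sub>R y) = c\<^sup>2 * det2 x y" for x y by (simp add: power2_eq_square)
  show "(*\<^sub>R) c ` Q \<in> polygons n B'" "area ((*\<^sub>R) c ` Q) = c\<^sup>2 * area Q"
    using polygons_linear_image[OF L d _ Q B'] c by simp_all
qed

lemma area_le_mu_mstar_self_polar:
  assumes "K \<in> K2o" "det_polar K = K" "Q \<in> polygons n K"
  shows "area Q \<le> mu_mstar n K"
  using mu_mstar_upper[OF assms(1,3)] area_min_circ_self_polar[OF assms(1,2)] by simp

lemma mu_mstar_self_polar_le:
  assumes "K \<in> K2o" "det_polar K = K" "3 \<le> n" "\<And>Q. Q \<in> polygons n K \<Longrightarrow> area Q \<le> c"
  shows "mu_mstar n K \<le> c"
  by (rule mu_mstar_least[OF assms(1,3)]) (simp add: area_min_circ_self_polar[OF assms(1,2)] assms(4))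

text \<open>A polygon in \<open>K\<close>, dilated by \<open>c\<close>, lies in \<open>B\<close>.
  The factor \<open>c\<^sup>2\<close> in its area cancels against the area
  \<open>4 * c\<^sup>2\<close> of the parallelogram about \<open>B\<close>.\<close>

lemma exists_self_polar_mu_le:
  assumes B: "B \<in> K2o" and n: "3 \<le> n"
  obtains K where "K \<in> K2o" "det_polar K = K" "mu_mstar n K \<le> mu_mstar n B"
proof -
  obtain K c where K: "K \<in> K2o" "det_polar K = K" and c: "c > 0" "(*\<^sub>R) c ` K \<subseteq> B" "area (min_circ B) = 4 * c\<^sup>2"
    using self_polar_inside[OF B] .
  have "mu_mstar n K \<le> mu_mstar n B"
  proof (rule mu_mstar_self_polar_le[OF K n])
    fix Q assume "Q \<in> polygons n K"
    note Q = polygons_dilate[OF this c(1,2)]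
    show "area Q \<le> mu_mstar n B"
      using mu_mstar_upper[OF B Q(1)] c(1) unfolding Q(2) c(3) by simp
  qed
  then show ?thesis using that K by blast
qed

lemma symmetric_parallelogram_hull:
  assumes "det2 x y \<noteq> 0"
  shows "parallelogram (convex hull {x, y, - x, - y})"
    "vertices (convex hull {x, y, - x, - y}) = {x, y, - x, - y}"
    "area (convex hull {x, y, - x, - y}) = 2 * \<bar>det2 x y\<bar>"
proof -
  \<comment> \<open>The parallelogram is read from the corner \<open>x\<close>, with edges towards
    \<open>y\<close> and \<open>- y\<close>.\<close>
  have e: "{x, y, - x, - y} = {x, x + (y - x), x + (y - x) + (- y - x), x + (- y - x)}" by auto
  have d: "det2 (y - x) (- y - x) = 2 * det2 x y" by (simp add: det2_swap[of y x])
  show "parallelogram (convex hull {x, y, - x, - y})" unfolding e using assms d by (intro parallelogramI) simp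
  show "vertices (convex hull {x, y, - x, - y}) = {x, y, - x, - y}"
    unfolding e using assms d by (intro vertices_parallelogram_hull) simp
  show "area (convex hull {x, y, - x, - y}) = 2 * \<bar>det2 x y\<bar>"
    unfolding e area_parallelogram_hull d by simp
qed

text \<open>In a self-polar set, a pair of determinant 1 and its negatives span a parallelogram of
  area 2.\<close>

lemma mu_mstar_4_ge_2:
  assumes B: "B \<in> K2o"
  shows "2 \<le> mu_mstar 4 B"
proof -
  obtain K where K: "K \<in> K2o" "det_polar K = K" "mu_mstar 4 K \<le> mu_mstar 4 B"
    using exists_self_polar_mu_le[OF B, of 4] by auto
  obtain p q where pq: "p \<in> K" "q \<in> K" "det2 p q = 1" using self_polar_unit_pair[OF K(1,2)] .
  let ?R = "convex hull {p, q, - p, - q}"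
  have R: "area ?R = 2" using symmetric_parallelogram_hull(3)[of p q] pq by simp
  then have "convex_polygon ?R" "card (vertices ?R) \<le> card {p, q, - p, - q}" by (auto intro: convex_polygon_hull)
  moreover have "card {p, q, - p, - q} \<le> 4" by (simp add: card_insert_if)
  moreover have "?R \<subseteq> K" using pq K2oD[OF K(1)] by (simp add: hull_minimal o_symmetric_iff)
  ultimately have "?R \<in> polygons 4 K" by (auto simp: polygons_def)
  from area_le_mu_mstar_self_polar[OF K(1,2) this] show ?thesis using R K(3) by simp
qed

section \<open>Frontiers of self-polar sets as Radon curves\<close>

lemma closed_convex_curve_frontier:
  assumes B: "B \<in> K2o"
  shows "closed_convex_curve (frontier B)"
proof -
  have "aff_dim B = 2" using B aff_dim_nonempty_interior[of B] by (auto simp: K2o_def)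
  moreover have "aff_dim (cball 0 1 :: complex set) = 2" by (simp add: aff_dim_cball)
  ultimately have "rel_frontier (cball 0 1 :: complex set) homeomorphic rel_frontier B"
    using K2oD[OF B] by (intro homeomorphic_rel_frontiers_convex_bounded_sets) auto
  moreover have "rel_frontier (cball 0 1 :: complex set) = sphere 0 1"
    by (simp add: rel_frontier_cball)
  moreover have "rel_frontier B = frontier B"
    using B by (intro rel_frontier_nonempty_interior) (auto simp: K2o_def)
  ultimately obtain f g where fg: "homeomorphism (sphere (0::complex) 1) (frontier B) f g"
    unfolding homeomorphic_def by auto
  have "simple_path (f \<circ> circlepath 0 1)"
    using fg by (intro simple_path_continuous_image)
      (auto simp: simple_path_circlepath homeomorphism_def intro: inj_on_inverseI[of _ g])
  moreover have "path_image (f \<circ> circlepath 0 1) = frontier B"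
    using fg by (simp add: path_image_compose homeomorphism_def)
  moreover have "pathfinish (f \<circ> circlepath 0 1) = pathstart (f \<circ> circlepath 0 1)"
    by (simp add: pathfinish_compose pathstart_compose)
  moreover have "convex (inside (frontier B))"
    using K2oD[OF B] by (simp add: inside_frontier_eq_interior convex_interior)
  ultimately show ?thesis unfolding closed_convex_curve_def by blast
qed

lemma o_symmetric_frontier: 
  assumes "B \<in> K2o"
  shows "o_symmetric (frontier B)"
proof -
  have "uminus ` interior B = interior (uminus ` B)"
    by (rule interior_bijective_linear_image[symmetric]) (auto simp: linear_uminus bij_uminus)
  then have "uminus ` interior B = interior B" using K2oD(3)[OF assms] by (simp add: o_symmetric_def)
  then have "- x \<in> interior B \<longleftrightarrow> x \<in> interior B" for x
    by (metis image_eqI minus_minus)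
  then show ?thesis
    using K2oD(3,5)[OF assms] by (auto simp: o_symmetric_iff frontier_def)
qed

lemma inscribed_parallelogram_area_le:
  assumes B: "B \<in> K2o" and D: "\<And>x y. x \<in> B \<Longrightarrow> y \<in> B \<Longrightarrow> \<bar>det2 x y\<bar> \<le> D"
    and P: "inscribed_parallelogram (frontier B) P"
  shows "area P \<le> 2 * D"
proof -
  obtain a u v where uv: "det2 u v \<noteq> 0" "P = convex hull {a, a + u, a + u + v, a + v}"
    using P parallelogramE unfolding inscribed_parallelogram_def by metis
  have aP: "area P = \<bar>det2 u v\<bar>" unfolding uv by (rule area_parallelogram_hull)
  have vP: "vertices P = {a, a + u, a + u + v, a + v}" unfolding uv by (rule vertices_parallelogram_hull[OF uv(1)])
  have cp: "convex_polygon P" unfolding uv using aP uv by (intro convex_polygon_hull) auto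
  have "vertices P \<subseteq> B"
    using P K2oD(5)[OF B] by (auto simp: inscribed_parallelogram_def frontier_def)
  then have "P \<subseteq> B" using convex_polygon_vertices(2)[OF cp] K2oD(2)[OF B] by (metis hull_minimal)
  moreover have "card (vertices P) \<le> 4" unfolding vP by (simp add: card_insert_if)
  ultimately show ?thesis using area_quadrilateral_le[OF K2oD(2,3)[OF B] D cp] by blast
qed

text \<open>An interior \<open>y\<close> could be lengthened within \<open>B\<close>, which would
  push \<open>det2 x y\<close> above its maximum.\<close>

lemma max_det2_frontier:
  assumes B: "B \<in> K2o" and D: "\<And>x y. x \<in> B \<Longrightarrow> y \<in> B \<Longrightarrow> \<bar>det2 x y\<bar> \<le> D"
    and xy: "x \<in> B" "y \<in> B" "det2 x y = D" "D > 0"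
  shows "y \<in> frontier B"
proof -
  have "y \<notin> interior B"
  proof
    assume "y \<in> interior B"
    then obtain e where e: "e > 0" "cball y e \<subseteq> B" using mem_interior_cball by blast
    have y0: "y \<noteq> 0" using xy by auto
    have "y + (e / norm y) *\<^sub>R y \<in> cball y e" using e y0 by (simp add: dist_norm)
    then have "\<bar>det2 x (y + (e / norm y) *\<^sub>R y)\<bar> \<le> D"
      using D[OF xy(1)] e by blast
    moreover define r where "r = e / norm y * D"
    ultimately have "\<bar>D + r\<bar> \<le> D" using xy(3) by simp
    moreover have "r > 0" using e y0 xy(4) by (simp add: r_def)
    ultimately show False by linarith
  qed
  then show ?thesis using xy(2) K2oD(5)[OF B] by (simp add: frontier_def)
qed

text \<open>A frontier point \<open>x\<close> has a partner \<open>y\<close> with determinant 1. The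
  parallelogram with vertices \<open>x\<close>, \<open>y\<close> and their negatives has area 2,
  which bounds the area of every inscribed parallelogram.\<close>

lemma radon_curve_self_polar:
  assumes K: "K \<in> K2o" "det_polar K = K"
  shows "radon_curve (frontier K)"
  unfolding radon_curve_def
proof (intro conjI ballI)
  show "o_symmetric (frontier K)" by (rule o_symmetric_frontier[OF K(1)])
  show "closed_convex_curve (frontier K)" by (rule closed_convex_curve_frontier[OF K(1)])
  fix x assume x: "x \<in> frontier K"
  then have xK: "x \<in> K" using K2oD(5)[OF K(1)] by (auto simp: frontier_def)
  obtain y where y: "y \<in> K" "det2 x y = 1" using self_polar_frontier_partner[OF K x] .
  let ?R = "convex hull {x, y, - x, - y}"
  have R: "parallelogram ?R" "vertices ?R = {x, y, - x, - y}" "area ?R = 2"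
    using symmetric_parallelogram_hull[of x y] y(2) by auto
  have "y \<in> frontier K"
    using max_det2_frontier[OF K(1) self_polar_abs_det2_le[OF K(2)] xK y] by simp
  then have "vertices ?R \<subseteq> frontier K"
    unfolding R using x o_symmetric_frontier[OF K(1)] by (auto simp: o_symmetric_iff)
  then have "max_inscribed_parallelogram (frontier K) ?R"
    using R inscribed_parallelogram_area_le[OF K(1) self_polar_abs_det2_le[OF K(2)]]
    by (auto simp: max_inscribed_parallelogram_def inscribed_parallelogram_def)
  then show "\<exists>P. max_inscribed_parallelogram (frontier K) P \<and> x \<in> vertices P" using R by blast
qed

section \<open>Existence of a minimizer\<close>

text \<open>Pass to coordinates with respect to a pair \<open>p\<close>, \<open>q\<close> of
  determinant 1: this unimodular change preserves self-polarity and the areas of polygons.\<close>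

lemma self_polar_normalize:
  assumes K: "K \<in> K2o" "det_polar K = K"
  obtains K' where "det_polar K' = K'" "axis 1 1 \<in> K'" "axis 2 1 \<in> K'"
    "\<And>Q. Q \<in> polygons n K' \<Longrightarrow> area Q \<le> mu_mstar n K"
proof -
  obtain p q where pq: "p \<in> K" "q \<in> K" "det2 p q = 1" using self_polar_unit_pair[OF K] .
  define M :: "plane \<Rightarrow> plane" where "M = (\<lambda>w. w $ 1 *\<^sub>R p + w $ 2 *\<^sub>R q)"
  have lin: "linear M" unfolding M_def by (auto intro!: linearI simp: algebra_simps)
  have det: "det2 (M w) (M w') = det2 w w'" for w w'
    using pq(3) det2_swap[of q p] by (simp add: M_def det2_def[of w w'])
  have surj: "\<exists>w. z = M w" for z
  proof -
    have "z = M (vector [det2 z q, det2 p z])" using det2_scaled_identity[of p q z] pq(3) by (simp add: M_def)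
    then show ?thesis by blast
  qed
  define K' where "K' = M -` K"
  have "w \<in> det_polar K' \<longleftrightarrow> w \<in> K'" for w
  proof -
    have "w \<in> det_polar K' \<longleftrightarrow> (\<forall>w'. M w' \<in> K \<longrightarrow> \<bar>det2 (M w) (M w')\<bar> \<le> 1)"
      by (auto simp: det_polar_def K'_def det)
    also have "\<dots> \<longleftrightarrow> (\<forall>z\<in>K. \<bar>det2 (M w) z\<bar> \<le> 1)" using surj by metis
    also have "\<dots> \<longleftrightarrow> M w \<in> det_polar K" by (simp add: det_polar_def)
    finally show ?thesis by (simp add: K K'_def)
  qed
  then have sp: "det_polar K' = K'" by blast
  have ax: "axis 1 1 \<in> K'" "axis 2 1 \<in> K'" using pq by (auto simp: K'_def M_def axis_def)
  have "area Q \<le> mu_mstar n K" if Q: "Q \<in> polygons n K'" for Q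
  proof -
    have "M ` K' \<subseteq> K" by (auto simp: K'_def)
    from polygons_linear_image[OF lin, of 1, OF _ _ Q this] det
    have "M ` Q \<in> polygons n K" "area (M ` Q) = area Q" by simp_all
    then show ?thesis using area_le_mu_mstar_self_polar[OF K] by metis
  qed
  then show ?thesis using that sp ax by blast
qed

section \<open>Gauges of normalized self-polar sets\<close>

lemma norm_le_2_if_det2_axis_le_1:
  assumes "\<bar>det2 (axis 1 1) z\<bar> \<le> 1" "\<bar>det2 (axis 2 1) z\<bar> \<le> 1"
  shows "norm z \<le> 2"
proof -
  have "\<bar>z $ 2\<bar> \<le> 1" "\<bar>z $ 1\<bar> \<le> 1" using assms by (simp_all add: det2_def axis_def)
  then show ?thesis using norm_le_l1_cart[of z] by (simp add: sum_2)
qed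

text \<open>For the self-polar sets below, this is the norm with unit ball \<open>K\<close>. As a
  supremum of functions \<open>\<bar>det2 p z\<bar>\<close>, it inherits their common Lipschitz
  constant.\<close>

definition det_gauge :: "plane set \<Rightarrow> plane \<Rightarrow> real" where
  "det_gauge K z = (SUP p\<in>K. \<bar>det2 p z\<bar>)"

context
  fixes K :: "plane set"
  assumes self_polar: "det_polar K = K" and axes: "axis 1 1 \<in> K" "axis 2 1 \<in> K"
begin

lemma normalized_norm_le: "z \<in> K \<Longrightarrow> norm z \<le> 2"
  using axes self_polar_abs_det2_le[OF self_polar] by (intro norm_le_2_if_det2_axis_le_1) auto

lemma normalized_abs_det2_le: "p \<in> K \<Longrightarrow> \<bar>det2 p z\<bar> \<le> 2 * norm z"
  using abs_det2_le_norm[of p z] mult_right_mono[OF normalized_norm_le, of p "norm z"] by simp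

lemma det_gauge_upper: "p \<in> K \<Longrightarrow> \<bar>det2 p z\<bar> \<le> det_gauge K z"
  unfolding det_gauge_def
  by (rule cSUP_upper) (auto intro!: bdd_aboveI2[of _ _ "2 * norm z"] normalized_abs_det2_le)

lemma det_gauge_least: "(\<And>p. p \<in> K \<Longrightarrow> \<bar>det2 p z\<bar> \<le> c) \<Longrightarrow> det_gauge K z \<le> c"
  unfolding det_gauge_def by (rule cSUP_least) (use axes in auto)

lemma det_gauge_le_1: "z \<in> K \<Longrightarrow> det_gauge K z \<le> 1"
  using self_polar_abs_det2_le[OF self_polar] by (intro det_gauge_least) auto

lemma dilate_mem_if_det_gauge_le:
  assumes "det_gauge K z \<le> c" "0 < c"
  shows "(1/c) *\<^sub>R z \<in> K"
proof -
  have "\<bar>det2 ((1/c) *\<^sub>R z) p\<bar> \<le> 1" if "p \<in> K" for p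
    using det_gauge_upper[OF that, of z] assms abs_det2_commute[of z p] by (simp add: abs_mult)
  then show ?thesis using self_polar unfolding det_polar_def by blast
qed

lemma det_gauge_nonneg: "0 \<le> det_gauge K z"
  using det_gauge_upper[OF axes(1)] abs_ge_zero order_trans by blast

text \<open>The constant 2 bounds the norms of points of \<open>K\<close> and does not depend on
  \<open>K\<close>; this is the equicontinuity required for the Arzela-Ascoli theorem.\<close>

lemma det_gauge_lipschitz: "\<bar>det_gauge K x - det_gauge K y\<bar> \<le> 2 * norm (x - y)"
proof -
  have "det_gauge K x \<le> det_gauge K y + 2 * norm (x - y)" for x y
  proof (rule det_gauge_least)
    fix p assume p: "p \<in> K"
    have "\<bar>det2 p x\<bar> \<le> \<bar>det2 p y\<bar> + \<bar>det2 p (x - y)\<bar>" by simp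
    then show "\<bar>det2 p x\<bar> \<le> det_gauge K y + 2 * norm (x - y)"
      using det_gauge_upper[OF p, of y] normalized_abs_det2_le[OF p, of "x - y"] by linarith
  qed
  from this[of x y] this[of y x] show ?thesis by (simp add: norm_minus_commute abs_le_iff)
qed

end

text \<open>Let \<open>e\<close> tend to 0 from the right. The square is the effect of a dilation by
  \<open>1 + e\<close> on areas and determinants; the added \<open>e\<close> is the slack in a
  bound.\<close>

lemma le_if_le_perturbed:
  fixes a b :: real
  assumes "\<And>e. 0 < e \<Longrightarrow> a \<le> (1 + e)\<^sup>2 * (b + e)"
  shows "a \<le> b"
proof (rule tendsto_lowerbound)
  show "((\<lambda>e. (1 + e)\<^sup>2 * (b + e)) \<longlongrightarrow> b) (at_right 0)"
    by (auto intro!: tendsto_eq_intros)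
  show "\<forall>\<^sub>F e in at_right 0. a \<le> (1 + e)\<^sup>2 * (b + e)"
    by (rule eventually_mono[OF eventually_at_right_less]) (rule assms)
qed simp

text \<open>A selection theorem of Blaschke type: a subsequence of gauges converges uniformly on a
  disc containing all the sets, and \<open>K\<close> is the unit ball of the limit. For comparing
  polygons it suffices that each proper shrinking of \<open>K\<close> eventually lies in the sets of
  the subsequence.\<close>

lemma self_polar_selection:
  fixes F :: "nat \<Rightarrow> plane set"
  assumes F: "\<And>i. det_polar (F i) = F i" "\<And>i. axis 1 1 \<in> F i" "\<And>i. axis 2 1 \<in> F i"
  obtains K and k :: "nat \<Rightarrow> nat" where "strict_mono k" "K \<in> K2o" "det_polar K = K"
    "\<And>e. 0 < e \<Longrightarrow> \<exists>N. \<forall>i\<ge>N. (*\<^sub>R) (1/(1+e)) ` K \<subseteq> F (k i)"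
proof -
  note bnd = normalized_norm_le[OF F] and upper = det_gauge_upper[OF F] and least = det_gauge_least[OF F]
    and le1 = det_gauge_le_1[OF F] and dil = dilate_mem_if_det_gauge_le[OF F]
  let ?S = "cball (0::plane) 2"
  have bound: "norm (det_gauge (F n) x) \<le> 4" if "x \<in> ?S" for n x
  proof -
    have "det_gauge (F n) x \<le> 4"
      using normalized_abs_det2_le[OF F, of _ n x] that by (intro least) force
    then show ?thesis using det_gauge_nonneg[OF F, of n x] by simp
  qed
  have equi: "\<exists>d>0. \<forall>n y. y \<in> ?S \<and> norm (x - y) < d \<longrightarrow> norm (det_gauge (F n) x - det_gauge (F n) y) < e"
    if "x \<in> ?S" "0 < e" for x e
  proof (intro exI[of _ "e/2"] conjI allI impI)
    fix n y assume "y \<in> ?S \<and> norm (x - y) < e / 2"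
    then show "norm (det_gauge (F n) x - det_gauge (F n) y) < e"
      using det_gauge_lipschitz[OF F, of n x y] by simp
  qed (use that in simp)
  obtain g and k :: "nat \<Rightarrow> nat" where "continuous_on ?S g" and k: "strict_mono k"
    and lim: "\<And>e. 0 < e \<Longrightarrow> \<exists>N. \<forall>n x. n \<ge> N \<and> x \<in> ?S \<longrightarrow> norm (det_gauge (F (k n)) x - g x) < e"
    by (rule Arzela_Ascoli[OF compact_cball bound equi]) blast+
  define K where "K = {z \<in> ?S. g z \<le> 1}"
  have memK: "x \<in> K" if x: "\<And>j. N \<le> j \<Longrightarrow> x \<in> F (k j)" for x N
  proof -
    have "x \<in> ?S" using bnd[OF x[of N]] by simp
    moreover have "g x \<le> 1"
    proof (rule field_le_epsilon)
      fix e :: real assume "0 < e"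
      then obtain N' where N': "\<forall>n x. n \<ge> N' \<and> x \<in> ?S \<longrightarrow> norm (det_gauge (F (k n)) x - g x) < e"
        using lim by blast
      have "norm (det_gauge (F (k (max N N'))) x - g x) < e" using N' \<open>x \<in> ?S\<close> by simp
      then show "g x \<le> 1 + e" using le1[OF x[of "max N N'"]] by (simp add: abs_less_iff)
    qed
    ultimately show ?thesis by (simp add: K_def)
  qed
  have inner: "\<exists>N. \<forall>i\<ge>N. (*\<^sub>R) (1/(1+e)) ` K \<subseteq> F (k i)" if e: "0 < e" for e
  proof -
    obtain N where N: "\<forall>n x. n \<ge> N \<and> x \<in> ?S \<longrightarrow> norm (det_gauge (F (k n)) x - g x) < e"
      using lim[OF e] by blast
    have "(1/(1+e)) *\<^sub>R z \<in> F (k i)" if "i \<ge> N" "z \<in> K" for i z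
    proof (rule dil)
      have "norm (det_gauge (F (k i)) z - g z) < e" using N that by (simp add: K_def)
      then show "det_gauge (F (k i)) z \<le> 1 + e" using that by (simp add: K_def abs_less_iff)
    qed (use e in simp)
    then show ?thesis by blast
  qed
  have axK: "axis 1 1 \<in> K" "axis 2 1 \<in> K" using F memK by auto
  have "det_polar K = K"
  proof
    show "K \<subseteq> det_polar K"
    proof -
      have "\<bar>det2 x y\<bar> \<le> 1" if xy: "x \<in> K" "y \<in> K" for x y
      proof (rule le_if_le_perturbed)
        fix e :: real assume e: "0 < e"
        then obtain N where N: "\<forall>i\<ge>N. (*\<^sub>R) (1/(1+e)) ` K \<subseteq> F (k i)" using inner by blast
        \<comment> \<open>Both shrunken points lie in one self-polar set, which bounds their
          determinant by 1.\<close>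
        have "(1/(1+e)) *\<^sub>R x \<in> F (k N)" "(1/(1+e)) *\<^sub>R y \<in> F (k N)" using N xy by auto
        then have "\<bar>det2 ((1/(1+e)) *\<^sub>R x) ((1/(1+e)) *\<^sub>R y)\<bar> \<le> 1" using self_polar_abs_det2_le[OF F(1)] by blast
        moreover have "\<bar>det2 ((1/(1+e)) *\<^sub>R x) ((1/(1+e)) *\<^sub>R y)\<bar> = \<bar>det2 x y\<bar> / (1 + e)\<^sup>2"
          using e by (simp add: abs_mult power2_eq_square)
        ultimately have "\<bar>det2 x y\<bar> \<le> (1 + e)\<^sup>2" using e by (simp add: divide_le_eq power2_eq_square)
        also have "\<dots> \<le> (1 + e)\<^sup>2 * (1 + e)" using e mult_left_mono[of 1 "1 + e" "(1 + e)\<^sup>2"] by simp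
        finally show "\<bar>det2 x y\<bar> \<le> (1 + e)\<^sup>2 * (1 + e)" .
      qed
      then show ?thesis by (auto simp: det_polar_def)
    qed
    show "det_polar K \<subseteq> K"
    proof
      fix z assume z: "z \<in> det_polar K"
      have zK: "\<bar>det2 p z\<bar> \<le> 1" if "p \<in> K" for p
        using z that abs_det2_commute[of p z] by (auto simp: det_polar_def)
      have zS: "z \<in> ?S" using norm_le_2_if_det2_axis_le_1 zK axK by simp
      moreover have "g z \<le> 1"
      proof (rule field_le_epsilon)
        fix e' :: real assume "0 < e'"
        \<comment> \<open>Two thirds pay for comparing the gauges at two indices through the limit,
          one third for passing from the gauge at index \<open>N\<close> to
          \<open>g\<close>.\<close>
        define e where "e = e' / 3"
        have e: "0 < e" using \<open>0 < e'\<close> by (simp add: e_def)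
        obtain N where N: "\<forall>n x. n \<ge> N \<and> x \<in> ?S \<longrightarrow> norm (det_gauge (F (k n)) x - g x) < e"
          using lim[OF e] by blast
        have "det_gauge (F (k N)) z \<le> 1 + 2 * e"
        proof (rule least)
          fix p assume p: "p \<in> F (k N)"
          have pS: "p \<in> ?S" using bnd[OF p] by simp
          \<comment> \<open>From index \<open>N\<close> on, the gauges at \<open>p\<close> differ by
            less than \<open>2 * e\<close>, so the shrunken \<open>p\<close> lies in all later sets,
            hence in \<open>K\<close>, where the hypothesis on \<open>z\<close> applies.\<close>
          have "(1/(1+2*e)) *\<^sub>R p \<in> F (k j)" if "N \<le> j" for j
          proof (rule dil)
            have "norm (det_gauge (F (k j)) p - g p) < e" "norm (det_gauge (F (k N)) p - g p) < e"
              using N that pS by auto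
            then show "det_gauge (F (k j)) p \<le> 1 + 2 * e" using le1[OF p] unfolding real_norm_def by linarith
          qed (use e in simp)
          then have "(1/(1+2*e)) *\<^sub>R p \<in> K" by (rule memK)
          from zK[OF this] show "\<bar>det2 p z\<bar> \<le> 1 + 2 * e" using e by (simp add: abs_mult)
        qed
        moreover have "norm (det_gauge (F (k N)) z - g z) < e" using N zS by simp
        ultimately show "g z \<le> 1 + e'" unfolding real_norm_def e_def by linarith
      qed
      ultimately show "z \<in> K" by (simp add: K_def)
    qed
  qed
  moreover have "bounded K" by (rule bounded_subset[OF bounded_cball[of 0 2]]) (auto simp: K_def)
  ultimately show thesis using that[OF k _ _ inner] self_polar_in_K2o by blast
qed

lemma parallelogram_in_K2o_exists: "\<exists>B. B \<in> K2o \<and> parallelogram B"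
proof -
  let ?e = "axis 1 1 :: plane" and ?f = "axis 2 1 :: plane"
  let ?R = "convex hull {?e, ?f, - ?e, - ?f}"
  have d: "det2 ?e ?f = 1" by (simp add: det2_def axis_def)
  note R = symmetric_parallelogram_hull[of ?e ?f]
  have "uminus ` ?R = convex hull (uminus ` {?e, ?f, - ?e, - ?f})"
    by (rule convex_hull_linear_image) (simp add: linear_uminus)
  also have "uminus ` {?e, ?f, - ?e, - ?f} = {?e, ?f, - ?e, - ?f}" by auto
  finally have "o_symmetric ?R" by (simp add: o_symmetric_def)
  moreover have "interior ?R \<noteq> {}" using R(3) d by (intro area_pos_imp_interior) auto
  moreover have "compact ?R" by (intro finite_imp_compact_convex_hull) auto
  ultimately have "?R \<in> K2o" by (simp add: K2o_def)
  then show ?thesis using R(1) d by auto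
qed

lemma mu_mstar_minimizer:
  assumes n: "3 \<le> n"
  obtains K where "K \<in> K2o" "det_polar K = K" "mu_mstar n K = m_mstar n"
proof -
  have bdd: "bdd_below (mu_mstar n ` K2o)" by (rule bdd_belowI2[of _ 0]) (rule mu_mstar_nonneg[OF _ n])
  have ne: "K2o \<noteq> {}" using parallelogram_in_K2o_exists by blast
  \<comment> \<open>A minimizing sequence, replaced by normalized self-polar sets; its slack
    \<open>1 / (real i + 1)\<close> is stated for the areas of polygons.\<close>
  have "\<exists>K. det_polar K = K \<and> axis 1 1 \<in> K \<and> axis 2 1 \<in> K \<and>
    (\<forall>Q\<in>polygons n K. area Q \<le> m_mstar n + 1 / (real i + 1))" for i
  proof -
    have "m_mstar n < m_mstar n + 1 / (real i + 1)" by simp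
    then obtain B where B: "B \<in> K2o" "mu_mstar n B < m_mstar n + 1 / (real i + 1)"
      unfolding m_mstar_def using cINF_less_iff[OF ne bdd] by blast
    obtain K where K: "K \<in> K2o" "det_polar K = K" "mu_mstar n K \<le> mu_mstar n B"
      using exists_self_polar_mu_le[OF B(1) n] .
    obtain K' where K': "det_polar K' = K'" "axis 1 1 \<in> K'" "axis 2 1 \<in> K'"
      "\<And>Q. Q \<in> polygons n K' \<Longrightarrow> area Q \<le> mu_mstar n K"
      using self_polar_normalize[OF K(1,2)] by metis
    have "area Q \<le> m_mstar n + 1 / (real i + 1)" if "Q \<in> polygons n K'" for Q
      using K'(4)[OF that] K(3) B(2) by linarith
    then show ?thesis using K' by blast
  qed
  then obtain F where F: "\<And>i. det_polar (F i) = F i" "\<And>i. axis 1 1 \<in> F i" "\<And>i. axis 2 1 \<in> F i"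
    and Fle: "\<And>i Q. Q \<in> polygons n (F i) \<Longrightarrow> area Q \<le> m_mstar n + 1 / (real i + 1)" by metis
  obtain K and k :: "nat \<Rightarrow> nat" where k: "strict_mono k" and K: "K \<in> K2o" "det_polar K = K"
    and inner: "\<And>e. 0 < e \<Longrightarrow> \<exists>N. \<forall>i\<ge>N. (*\<^sub>R) (1/(1+e)) ` K \<subseteq> F (k i)"
    using self_polar_selection[of F, OF F] by metis
  have "mu_mstar n K \<le> m_mstar n"
  proof (rule mu_mstar_self_polar_le[OF K n])
    fix Q assume Q: "Q \<in> polygons n K"
    show "area Q \<le> m_mstar n"
    proof (rule le_if_le_perturbed)
      fix e :: real assume e: "0 < e"
      obtain N where N: "\<forall>i\<ge>N. (*\<^sub>R) (1/(1+e)) ` K \<subseteq> F (k i)" using inner[OF e] by blast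
      obtain N' where N': "1 / (real N' + 1) < e" using reals_Archimedean[OF e] by (auto simp: inverse_eq_divide add.commute)
      define i where "i = max N N'"
      \<comment> \<open>Indices of a subsequence are at least as large as their positions, so the
        slack at \<open>k i\<close> is below \<open>e\<close>.\<close>
      have "N' \<le> k i" using seq_suble[OF k, of i] by (simp add: i_def)
      then have "1 / (real (k i) + 1) \<le> 1 / (real N' + 1)" by (simp add: frac_le)
      then have ki: "1 / (real (k i) + 1) \<le> e" using N' by simp
      have c: "0 < 1 / (1 + e)" using e by simp
      have "(*\<^sub>R) (1/(1+e)) ` K \<subseteq> F (k i)" using N by (simp add: i_def)
        note dQ = polygons_dilate[OF Q c this]
      have "(1/(1+e))\<^sup>2 * area Q \<le> m_mstar n + e" using Fle[OF dQ(1)] dQ(2) ki by linarith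
      then show "area Q \<le> (1 + e)\<^sup>2 * (m_mstar n + e)" using e by (simp add: power_divide field_simps)
    qed
  qed
  moreover have "m_mstar n \<le> mu_mstar n K" unfolding m_mstar_def by (rule cINF_lower[OF bdd K(1)])
  ultimately show thesis using that[OF K] by simp
qed

section \<open>Radon curves\<close>

text \<open>Take a maximal inscribed parallelogram with vertex \<open>x\<close>; half of the
  diagonal that avoids \<open>x\<close> is the partner. The vertices \<open>p\<close>,
  \<open>q\<close> and their negatives show that its area is at least twice the maximum of
  \<open>det2\<close>.\<close>

lemma radon_frontier_partner:
  assumes B: "B \<in> K2o" "radon_curve (frontier B)" and x: "x \<in> frontier B"
    and pq: "p \<in> B" "q \<in> B" "det2 p q > 0"
    and D: "\<And>x y. x \<in> B \<Longrightarrow> y \<in> B \<Longrightarrow> \<bar>det2 x y\<bar> \<le> det2 p q"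
  obtains y where "y \<in> B" "\<bar>det2 x y\<bar> = det2 p q"
proof -
  obtain P where P: "max_inscribed_parallelogram (frontier B) P" "x \<in> vertices P"
    using B(2) x unfolding radon_curve_def by blast
  define d where "d = det2 p q"
  have sym: "- z \<in> B" if "z \<in> B" for z using that K2oD(3)[OF B(1)] by (simp add: o_symmetric_iff)
  have symf: "- z \<in> frontier B" if "z \<in> frontier B" for z
    using that o_symmetric_frontier[OF B(1)] by (simp add: o_symmetric_iff)
  have q: "q \<in> frontier B" using max_det2_frontier[OF B(1) D pq(1,2)] pq(3) by simp
  have "- p \<in> frontier B"
    using max_det2_frontier[OF B(1) D pq(2) sym[OF pq(1)]] pq(3) det2_swap[of q p] by simp
  then have p: "p \<in> frontier B" using symf by force
  let ?R = "convex hull {p, q, - p, - q}"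
  note R = symmetric_parallelogram_hull[of p q]
  have "inscribed_parallelogram (frontier B) ?R"
    using R pq(3) p q symf by (auto simp: inscribed_parallelogram_def)
  then have "area ?R \<le> area P" using P(1) by (auto simp: max_inscribed_parallelogram_def)
  then have ge: "2 * d \<le> area P" using R(3) pq(3) by (simp add: d_def)
  have insP: "inscribed_parallelogram (frontier B) P" using P(1) by (simp add: max_inscribed_parallelogram_def)
  then obtain a u v where uv: "det2 u v \<noteq> 0" "P = convex hull {a, a + u, a + u + v, a + v}"
    using parallelogramE unfolding inscribed_parallelogram_def by metis
  have aP: "2 * d \<le> \<bar>det2 u v\<bar>" using ge unfolding uv by (simp add: area_parallelogram_hull)
  have vP: "vertices P = {a, a + u, a + u + v, a + v}" unfolding uv by (rule vertices_parallelogram_hull[OF uv(1)])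
  have "vertices P \<subseteq> B" using insP K2oD(5)[OF B(1)] by (auto simp: inscribed_parallelogram_def frontier_def)
  then have V: "a \<in> B" "a + u \<in> B" "a + u + v \<in> B" "a + v \<in> B" unfolding vP by auto
  define w w' where w: "w = (1/2) *\<^sub>R ((a + v) - (a + u))" "w' = (1/2) *\<^sub>R ((a + u + v) - a)"
  have wB: "w \<in> B" "w' \<in> B" unfolding w using half_diff_in_symmetric[OF K2oD(2,3)[OF B(1)]] V by blast+
  \<comment> \<open>For opposite vertices, the determinants with half of the other diagonal differ
    by the area in absolute value, at least \<open>2 * d\<close>, while each is at most
    \<open>d\<close> in absolute value. So each attains \<open>d\<close>, even if the parallelogram
    is off centre.\<close>
  have "det2 (a + u + v) w - det2 a w = det2 u v" "det2 (a + v) w' - det2 (a + u) w' = - det2 u v"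
    unfolding w by (simp_all add: det2_swap[of v u] algebra_simps)
  moreover have "\<bar>det2 z y\<bar> \<le> d" if "z \<in> B" "y \<in> B" for z y using D that by (simp add: d_def)
  then have "\<bar>det2 (a + u + v) w\<bar> \<le> d" "\<bar>det2 a w\<bar> \<le> d" "\<bar>det2 (a + v) w'\<bar> \<le> d" "\<bar>det2 (a + u) w'\<bar> \<le> d"
    using V wB by blast+
  ultimately have "\<bar>det2 (a + u + v) w\<bar> = d" "\<bar>det2 a w\<bar> = d" "\<bar>det2 (a + v) w'\<bar> = d" "\<bar>det2 (a + u) w'\<bar> = d"
    using aP by linarith+
  then show thesis using that wB P(2) unfolding vP d_def by blast
qed

text \<open>With \<open>d\<close> the maximum of \<open>det2\<close> on \<open>B\<close>, the Radon
  property puts the polar scaled by \<open>d\<close> into \<open>B\<close>. Hence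
  \<open>det2\<close> is at most \<open>1 / d\<close> on the polar and the circumscribed area is at
  least \<open>4 * d\<close>, while quadrilaterals in \<open>B\<close> have area at most
  \<open>2 * d\<close>.\<close>

lemma mu_mstar_4_radon_le_2:
  assumes B: "B \<in> K2o" "radon_curve (frontier B)"
  shows "mu_mstar 4 B \<le> 2"
proof -
  obtain p q where pq: "p \<in> B" "q \<in> B" and D: "\<And>x y. x \<in> B \<Longrightarrow> y \<in> B \<Longrightarrow> \<bar>det2 x y\<bar> \<le> det2 p q"
    using det2_attains_max[of B] K2oD(1,6)[OF B(1)] by (metis empty_iff)
  obtain x0 y0 where "x0 \<in> B" "y0 \<in> B" "det2 x0 y0 > 0" using K2o_det2_pos[OF B(1)] .
  then have pos: "det2 p q > 0" using D[of x0 y0] by simp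
  define d where "d = det2 p q"
  have d: "d > 0" using pos by (simp add: d_def)
  have scaled: "d *\<^sub>R f \<in> B" if f: "f \<in> det_polar B" for f
  proof (cases "f = 0")
    case True then show ?thesis using K2oD(6)[OF B(1)] by simp
  next
    case False
    then obtain s where s: "0 < s" "0 + s *\<^sub>R f \<in> frontier B"
      using ray_to_frontier[OF K2oD(4)[OF B(1)] K2o_zero_interior[OF B(1)]] by metis
    then have sf: "s *\<^sub>R f \<in> frontier B" by simp
    then have sB: "s *\<^sub>R f \<in> B" using K2oD(5)[OF B(1)] by (auto simp: frontier_def)
    \<comment> \<open>The partner of the frontier point on the ray through \<open>f\<close> gives
      \<open>d \<le> s\<close>, so the segment from the origin to that point contains
      \<open>d *\<^sub>R f\<close>.\<close>
    obtain y where y: "y \<in> B" "\<bar>det2 (s *\<^sub>R f) y\<bar> = d"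
      using radon_frontier_partner[OF B sf pq pos D] unfolding d_def by metis
    have "\<bar>det2 f y\<bar> \<le> 1" using f y(1) by (auto simp: det_polar_def)
    then have "s * \<bar>det2 f y\<bar> \<le> s * 1" using s by (intro mult_left_mono) auto
    moreover have "d = s * \<bar>det2 f y\<bar>" using y(2) s(1) by (simp add: abs_mult)
    ultimately have ds: "d \<le> s" by linarith
    have "(1 - d/s) *\<^sub>R 0 + (d/s) *\<^sub>R (s *\<^sub>R f) \<in> B"
      using K2oD(2,6)[OF B(1)] sB d s ds by (intro convexD_alt) auto
    then show ?thesis using s by simp
  qed
  obtain p' q' where pq': "p' \<in> det_polar B" "q' \<in> det_polar B"
    and max: "\<And>x y. x \<in> det_polar B \<Longrightarrow> y \<in> det_polar B \<Longrightarrow> \<bar>det2 x y\<bar> \<le> det2 p' q'"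
    using det2_attains_max[of "det_polar B"] K2oD(1,6)[OF det_polar_in_K2o[OF B(1)]] by (metis empty_iff)
  note mc = min_circ_area_eq_max_polar[OF B(1) pq' max]
  have pos': "0 < det2 p' q'" and mc3: "area (min_circ B) = 4 / det2 p' q'" using mc by auto
  have "\<bar>det2 (d *\<^sub>R p') (d *\<^sub>R q')\<bar> \<le> d" using D scaled pq' unfolding d_def by blast
  then have "d * (d * det2 p' q') \<le> d * 1" using d pos' by (simp add: abs_mult)
  then have "d * det2 p' q' \<le> 1" using d by (simp only: mult_le_cancel_left_pos)
  then have mcd: "4 * d \<le> area (min_circ B)" unfolding mc3 using pos' by (simp add: field_simps)
  show ?thesis
  proof (rule mu_mstar_least[OF B(1)])
    fix Q assume "Q \<in> polygons 4 B"
    then have "area Q \<le> 2 * d"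
      using area_quadrilateral_le[OF K2oD(2,3)[OF B(1)] D] by (auto simp: polygons_def d_def)
    then have "4 * area Q \<le> 2 * area (min_circ B)" using mcd by simp
    then show "4 * area Q / area (min_circ B) \<le> 2"
      using min_circ_props(2)[OF B(1)] by (simp add: divide_le_eq)
  qed simp
qed

section \<open>The four statements assembled\<close>

lemma M_mstar_eq:
  assumes le: "\<And>B. B \<in> K2o \<Longrightarrow> mu_mstar n B \<le> c"
    and ge: "\<And>B. B \<in> K2o \<Longrightarrow> parallelogram B \<Longrightarrow> c \<le> mu_mstar n B"
  shows "M_mstar n = c \<and> (\<forall>B\<in>K2o. parallelogram B \<longrightarrow> mu_mstar n B = M_mstar n)"
proof -
  obtain B where B: "B \<in> K2o" "parallelogram B" using parallelogram_in_K2o_exists by blast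
  have "M_mstar n \<le> c" unfolding M_mstar_def using B by (intro cSUP_least le) auto
  moreover have "mu_mstar n B \<le> M_mstar n"
    unfolding M_mstar_def by (rule cSUP_upper[OF B(1)]) (auto intro: bdd_aboveI2 le)
  then have "c \<le> M_mstar n" using ge[OF B] by simp
  ultimately have "M_mstar n = c" by simp
  then show ?thesis using le ge by (auto intro: antisym)
qed

theorem theorem6p1:
  shows "(M_mstar 3 = 2 \<and>
            (\<forall>B\<in>K2o. parallelogram B \<longrightarrow> mu_mstar 3 B = M_mstar 3))
       \<and> (\<forall>n\<ge>4. M_mstar n = 4 \<and>
            (\<forall>B\<in>K2o. parallelogram B \<longrightarrow> mu_mstar n B = M_mstar n))
       \<and> (m_mstar 4 = 2 \<and>
            (\<forall>B\<in>K2o. radon_curve (frontier B) \<longrightarrow> mu_mstar 4 B = m_mstar 4))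
       \<and> (\<forall>n\<ge>3. \<exists>B\<in>K2o. mu_mstar n B = m_mstar n \<and> radon_curve (frontier B))"
proof -
  have 1: "M_mstar 3 = 2 \<and> (\<forall>B\<in>K2o. parallelogram B \<longrightarrow> mu_mstar 3 B = M_mstar 3)"
    by (intro M_mstar_eq mu_mstar_3_le_2 mu_mstar_parallelogram)
  have 2: "M_mstar n = 4 \<and> (\<forall>B\<in>K2o. parallelogram B \<longrightarrow> mu_mstar n B = M_mstar n)" if "n \<ge> 4" for n
    using that by (intro M_mstar_eq mu_mstar_le_4 mu_mstar_parallelogram(2)) auto
  have 4: "\<exists>B\<in>K2o. mu_mstar n B = m_mstar n \<and> radon_curve (frontier B)" if "n \<ge> 3" for n
    using mu_mstar_minimizer[OF that] radon_curve_self_polar by metis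
  have radon: "mu_mstar 4 B = 2" if "B \<in> K2o" "radon_curve (frontier B)" for B
    using mu_mstar_4_radon_le_2[OF that] mu_mstar_4_ge_2[OF that(1)] by simp
  \<comment> \<open>Some minimizer is bounded by a Radon curve, so the infimum equals the value 2
    common to all such sets.\<close>
  obtain B where "B \<in> K2o" "mu_mstar 4 B = m_mstar 4" "radon_curve (frontier B)" using 4[of 4] by auto
  then have 3: "m_mstar 4 = 2" using radon by metis
  show ?thesis using 1 2 3 4 radon by simp
qed

end
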